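(* Let $m\ge1$ and let $w_1,\dots,w_m$ be scalar weights supported on $\mathcal J$, all belonging to one of the following families (with $\mathcal J=\mathbb N_0$ in cases (a), (b), (c) and $\mathcal J=\{0,1,\dots,N\}$ in cases (d), (e)): (a) Charlier-type: $w_i(x)=\dfrac{b_i^x}{x!}$ with $b_i>0$; (b) Meixner-type: $w_i(x)=(\beta_i)_x\dfrac{c_i^x}{x!}$ with $\beta_i>0$ and $0<c_i<1$; (c) Mixed Charlier–Meixner type: each $w_i$ is either as in (a) or as in (b); (d) Krawtchouk-type: $w_i(x)=\binom{N}{x}p_i^x(1-p_i)^{N-x}$ with $0<p_i<1$ and fixed $N\in\mathbb N$; (e) Hahn-type: $w_i(x)=\binom{\alpha_i+x}{x}\binom{\beta_i+N-x}{N-x}$ with fixed $N\in\mathbb N$ and $\alpha_i,\beta_i>-1$ or $\alpha_i,\beta_i<-N$, satisfying $\alpha_i+\beta_i=\alpha_j+\beta_j+2$ for all odd $i$ and even $j$, $1\le i,j\le m$. Let $a_1,\dots,a_{m-1}\in\mathbb R\setminus\{0\}$, $$A=\sum_{j=1}^{\lfloor m/2\rfloor} a_{2j-1}E_{2j-1,2j}+\sum_{j=1}^{\lfloor (m-1)/2\rfloor} a_{2j}E_{2j+1,2j},\qquad T(x)=e^{Ax}=I+Ax,$$ and $W(x)=T(x)\operatorname{diag}(w_1(x),\dots,w_m(x))T(x)^*$ for $x\in\mathcal J$. Let $\{Q_n\}$ be the sequence of matrix-valued orthogonal polynomials for $W$ given by $$Q_n(x)=P_n(x)+AP_{n+1}(x)-\|P_n\|^2A^*\|P_{n-1}\|^{-2}P_{n-1}(x)-P_n(x)Ax+\|P_n\|^2A^*\|P_{n-1}\|^{-2}P_{n-1}(x)Ax,$$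 where $P_n=\operatorname{diag}(p_n^{w_1},\dots,p_n^{w_m})$ and $\|P_n\|^2=\operatorname{diag}(\|p_n^{w_1}\|^2,\dots,\|p_n^{w_m}\|^2)$, for $n\in\mathbb N_0$ if $\mathcal J=\mathbb N_0$ and for $n=0,\dots,N$ if $\mathcal J=\{0,\dots,N\}$. Then $\{Q_n\}$ is an eigenfunction of a second-order difference operator: there are a second-order matrix-valued difference operator $D$ and matrices $\Lambda_n(D)\in\operatorname{Mat}_m(\mathbb C)$ with $Q_n(x)\cdot D=\Lambda_n(D)Q_n(x)$ for all such $n$.
   Context: $(a)_0=1$, $(a)_n=a(a+1)\cdots(a+n-1)$ is the Pochhammer symbol; for real $a$ and integer $k\ge0$, $\binom{a+k}{k}=(a+1)_k/k!$. $E_{i,j}$ denotes the $m\times m$ matrix with $1$ in position $(i,j)$ and $0$ elsewhere; $^*$ is the conjugate transpose. Scalar weight supported on $\mathcal J$: a function $w:\mathbb Z\to\mathbb R$ with $w(x)>0$ for $x\in\mathcal J$, $w(x)=0$ for $x\notin\mathcal J$ (the displayed formulas are for $x\in\mathcal J$), and all moments $\sum_{x\in\mathcal J}x^nw(x)$ convergent. $\|p\|^2=\sum_{x\in\mathcal J}|p(x)|^2w(x)$. $p_n^{w}$ ($n\in\mathbb N_0$, or $0\le n\le N$ if $\mathcal J=\{0,\dots,N\}$) are the monic orthogonal polynomials: $p_n^w$ is monic of degree $n$ and $\sum_{x\in\mathcal J}p_n^w(x)\overline{p_k^w(x)}w(x)=0$ for $n\neq k$. If $\mathcal J=\{0,\dots,N\}$,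 one sets $p_{N+1}^{w}(x)=x(x-1)\cdots(x-N)$. For $n=0$ every term containing $P_{-1}$ is taken to be $0$. A sequence of orthogonal polynomials for $W$ is a sequence of $m\times m$ matrix polynomials $Q_n$ with $\deg Q_n=n$, invertible leading coefficient, and $\sum_{x\in\mathcal J}Q_n(x)W(x)Q_k(x)^*=0$ for $n\ne k$. Difference operators: $\Delta(f)(x)=f(x+1)-f(x)$, $\nabla(f)(x)=f(x)-f(x-1)$ (entrywise on matrix functions), acting from the right. "Second-order difference operator" means an operator of the form $D=\Delta F(x)+K(x)+\nabla G(x)$, with $F,K,G$ matrix polynomials in $x$ and $F,G$ not identically zero, acting by $P(x)\cdot D=(P(x+1)-P(x))F(x)+P(x)K(x)+(P(x)-P(x-1))G(x)$. *)

theory Defs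
  imports
    "HOL-Analysis.Infinite_Sum"
    "HOL-Library.Extended_Nat"
    "HOL-Computational_Algebra.Polynomial"
    "Jordan_Normal_Form.Matrix"
    "Jordan_Normal_Form.Schur_Decomposition"
begin

section \<open>Scalar weights\<close>

text \<open>An extended natural number \<open>N\<close> encodes the support: all nonnegative integers if
  \<open>N = \<infinity>\<close>, and \<open>{0, \<dots>, M}\<close> if \<open>N = enat M\<close>.\<close>

definition lattice :: "enat \<Rightarrow> int set" where
  "lattice N = {x. 0 \<le> x \<and> enat (nat x) \<le> N}"

definition degrees :: "enat \<Rightarrow> nat set" where
  "degrees N = {n. enat n \<le> N}"

definition scalar_weight :: "enat \<Rightarrow> (int \<Rightarrow> real) \<Rightarrow> bool" where
  "scalar_weight N w \<longleftrightarrow>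
     (\<forall>x\<in>lattice N. w x > 0) \<and> (\<forall>x. x \<notin> lattice N \<longrightarrow> w x = 0) \<and>
     (\<forall>n::nat. (\<lambda>x. of_int x ^ n * w x) summable_on lattice N)"

definition sqnorm :: "enat \<Rightarrow> (int \<Rightarrow> real) \<Rightarrow> complex poly \<Rightarrow> real" where
  "sqnorm N w q = (\<Sum>\<^sub>\<infinity>x\<in>lattice N. (cmod (poly q (of_int x)))\<^sup>2 * w x)"

text \<open>For finite support \<open>{0, \<dots>, M}\<close> the degree \<open>M + 1\<close> polynomial is fixed by convention; values
  of \<open>p\<close> beyond that index are unconstrained.\<close>

definition monic_orthogonal :: "enat \<Rightarrow> (int \<Rightarrow> real) \<Rightarrow> (nat \<Rightarrow> complex poly) \<Rightarrow> bool" where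
  "monic_orthogonal N w p \<longleftrightarrow>
     (\<forall>n\<in>degrees N. degree (p n) = n \<and> lead_coeff (p n) = 1) \<and>
     (\<forall>n\<in>degrees N. \<forall>k\<in>degrees N. n \<noteq> k \<longrightarrow>
        ((\<lambda>x. poly (p n) (of_int x) * cnj (poly (p k) (of_int x)) * complex_of_real (w x))
           has_sum 0) (lattice N)) \<and>
     (\<forall>M. N = enat M \<longrightarrow> p (Suc M) = (\<Prod>y\<in>{0..M}. [:- of_nat y, 1:]))"

definition charlier_weight :: "real \<Rightarrow> int \<Rightarrow> real" where
  "charlier_weight b x = (if x \<in> lattice \<infinity> then b ^ nat x / fact (nat x) else 0)"

definition meixner_weight :: "real \<Rightarrow> real \<Rightarrow> int \<Rightarrow> real" where
  "meixner_weight \<beta> c x =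
     (if x \<in> lattice \<infinity> then pochhammer \<beta> (nat x) * c ^ nat x / fact (nat x) else 0)"

definition krawtchouk_weight :: "nat \<Rightarrow> real \<Rightarrow> int \<Rightarrow> real" where
  "krawtchouk_weight M q x =
     (if x \<in> lattice (enat M)
      then real (M choose nat x) * q ^ nat x * (1 - q) ^ (M - nat x) else 0)"

text \<open>\<open>binom_shift a k\<close> is the binomial coefficient of \<open>a + k\<close> over \<open>k\<close>.\<close>

definition binom_shift :: "real \<Rightarrow> nat \<Rightarrow> real" where
  "binom_shift a k = pochhammer (a + 1) k / fact k"

definition hahn_weight :: "nat \<Rightarrow> real \<Rightarrow> real \<Rightarrow> int \<Rightarrow> real" where
  "hahn_weight M \<alpha> \<beta> x =
     (if x \<in> lattice (enat M)
      then binom_shift \<alpha> (nat x) * binom_shift \<beta> (M - nat x) else 0)"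

definition charlier_type :: "(int \<Rightarrow> real) \<Rightarrow> bool" where
  "charlier_type w \<longleftrightarrow> (\<exists>b>0. w = charlier_weight b)"

definition meixner_type :: "(int \<Rightarrow> real) \<Rightarrow> bool" where
  "meixner_type w \<longleftrightarrow> (\<exists>\<beta> c. \<beta> > 0 \<and> 0 < c \<and> c < 1 \<and> w = meixner_weight \<beta> c)"

definition krawtchouk_type :: "nat \<Rightarrow> (int \<Rightarrow> real) \<Rightarrow> bool" where
  "krawtchouk_type M w \<longleftrightarrow> (\<exists>q. 0 < q \<and> q < 1 \<and> w = krawtchouk_weight M q)"

definition hahn_family :: "nat \<Rightarrow> nat \<Rightarrow> (nat \<Rightarrow> int \<Rightarrow> real) \<Rightarrow> bool" where
  "hahn_family M m w \<longleftrightarrow> (\<exists>\<alpha> \<beta> :: nat \<Rightarrow> real.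
     (\<forall>i\<in>{1..m}. (\<alpha> i > -1 \<and> \<beta> i > -1 \<or> \<alpha> i < - real M \<and> \<beta> i < - real M) \<and>
        w i = hahn_weight M (\<alpha> i) (\<beta> i)) \<and>
     (\<forall>i\<in>{1..m}. \<forall>j\<in>{1..m}. odd i \<and> even j \<longrightarrow> \<alpha> i + \<beta> i = \<alpha> j + \<beta> j + 2))"

section \<open>Matrix polynomials and matrix weights\<close>

text \<open>A matrix polynomial is a matrix with polynomial entries.\<close>

definition eval_mat :: "complex poly mat \<Rightarrow> complex \<Rightarrow> complex mat" where
  "eval_mat P x = map_mat (\<lambda>q. poly q x) P"

definition const_mat :: "complex mat \<Rightarrow> complex poly mat" where
  "const_mat C = map_mat (\<lambda>c. [:c:]) C"

definition coeff_mat :: "complex poly mat \<Rightarrow> nat \<Rightarrow> complex mat" where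
  "coeff_mat P n = map_mat (\<lambda>q. coeff q n) P"

definition orthogonal_sequence ::
  "nat \<Rightarrow> enat \<Rightarrow> (int \<Rightarrow> complex mat) \<Rightarrow> (nat \<Rightarrow> complex poly mat) \<Rightarrow> bool" where
  "orthogonal_sequence m N W Q \<longleftrightarrow>
     (\<forall>n\<in>degrees N. Q n \<in> carrier_mat m m \<and>
        (\<forall>i<m. \<forall>j<m. degree (Q n $$ (i, j)) \<le> n) \<and> invertible_mat (coeff_mat (Q n) n)) \<and>
     (\<forall>n\<in>degrees N. \<forall>k\<in>degrees N. n \<noteq> k \<longrightarrow>
        (\<forall>i<m. \<forall>j<m.
          ((\<lambda>x. (eval_mat (Q n) (of_int x) * W x * mat_adjoint (eval_mat (Q k) (of_int x)))
                  $$ (i, j)) has_sum 0) (lattice N)))"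

text \<open>The library indexes matrices from \<open>0\<close>. The weights, the parameters \<open>a\<close> and the matrix units
  keep the customary indices \<open>1, \<dots>, m\<close>; hence the shifts by \<open>Suc\<close>.\<close>

definition unit_mat :: "nat \<Rightarrow> nat \<Rightarrow> nat \<Rightarrow> complex mat" where
  "unit_mat m i j = Matrix.mat m m (\<lambda>(r, s). if Suc r = i \<and> Suc s = j then 1 else 0)"

definition A_mat :: "nat \<Rightarrow> (nat \<Rightarrow> real) \<Rightarrow> complex mat" where
  "A_mat m a = Matrix.mat m m (\<lambda>rs.
     (\<Sum>j = 1..m div 2. complex_of_real (a (2*j - 1)) * unit_mat m (2*j - 1) (2*j) $$ rs) +
     (\<Sum>j = 1..(m - 1) div 2. complex_of_real (a (2*j)) * unit_mat m (2*j + 1) (2*j) $$ rs))"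

definition mat_exp :: "complex mat \<Rightarrow> complex mat" where
  "mat_exp B = Matrix.mat (dim_row B) (dim_row B) (\<lambda>rs. \<Sum>k. (B ^\<^sub>m k) $$ rs / fact k)"

definition T_mat :: "nat \<Rightarrow> (nat \<Rightarrow> real) \<Rightarrow> complex \<Rightarrow> complex mat" where
  "T_mat m a x = mat_exp (x \<cdot>\<^sub>m A_mat m a)"

definition W_mat :: "nat \<Rightarrow> (nat \<Rightarrow> real) \<Rightarrow> (nat \<Rightarrow> int \<Rightarrow> real) \<Rightarrow> int \<Rightarrow> complex mat" where
  "W_mat m a w x =
     T_mat m a (of_int x) * mat_diag m (\<lambda>i. complex_of_real (w (Suc i) x))
       * mat_adjoint (T_mat m a (of_int x))"

definition P_mat :: "nat \<Rightarrow> (nat \<Rightarrow> nat \<Rightarrow> complex poly) \<Rightarrow> nat \<Rightarrow> complex poly mat" where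
  "P_mat m p n = mat_diag m (\<lambda>i. p (Suc i) n)"

definition norm2_mat ::
  "nat \<Rightarrow> enat \<Rightarrow> (nat \<Rightarrow> int \<Rightarrow> real) \<Rightarrow> (nat \<Rightarrow> nat \<Rightarrow> complex poly) \<Rightarrow> nat \<Rightarrow> complex mat" where
  "norm2_mat m N w p n =
     mat_diag m (\<lambda>i. complex_of_real (sqnorm N (w (Suc i)) (p (Suc i) n)))"

definition norm2_inv_mat ::
  "nat \<Rightarrow> enat \<Rightarrow> (nat \<Rightarrow> int \<Rightarrow> real) \<Rightarrow> (nat \<Rightarrow> nat \<Rightarrow> complex poly) \<Rightarrow> nat \<Rightarrow> complex mat" where
  "norm2_inv_mat m N w p n =
     mat_diag m (\<lambda>i. inverse (complex_of_real (sqnorm N (w (Suc i)) (p (Suc i) n))))"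

text \<open>\<open>B_mat\<close> is the common term of \<open>Q_mat\<close> containing the polynomials of index \<open>n - 1\<close>; it
  vanishes for \<open>n = 0\<close>.\<close>

definition B_mat ::
  "nat \<Rightarrow> enat \<Rightarrow> (nat \<Rightarrow> real) \<Rightarrow> (nat \<Rightarrow> int \<Rightarrow> real) \<Rightarrow> (nat \<Rightarrow> nat \<Rightarrow> complex poly) \<Rightarrow> nat
     \<Rightarrow> complex poly mat" where
  "B_mat m N a w p n =
     (if n = 0 then 0\<^sub>m m m
      else const_mat (norm2_mat m N w p n * mat_adjoint (A_mat m a) * norm2_inv_mat m N w p (n - 1))
             * P_mat m p (n - 1))"

definition Q_mat ::
  "nat \<Rightarrow> enat \<Rightarrow> (nat \<Rightarrow> real) \<Rightarrow> (nat \<Rightarrow> int \<Rightarrow> real) \<Rightarrow> (nat \<Rightarrow> nat \<Rightarrow> complex poly) \<Rightarrow> nat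
     \<Rightarrow> complex poly mat" where
  "Q_mat m N a w p n =
     P_mat m p n + const_mat (A_mat m a) * P_mat m p (Suc n) - B_mat m N a w p n
       - P_mat m p n * ([:0, 1:] \<cdot>\<^sub>m const_mat (A_mat m a))
       + B_mat m N a w p n * ([:0, 1:] \<cdot>\<^sub>m const_mat (A_mat m a))"

section \<open>Difference operators\<close>

definition fwd_diff :: "complex poly mat \<Rightarrow> complex poly mat" where
  "fwd_diff P = map_mat (\<lambda>q. pcompose q [:1, 1:] - q) P"

definition bwd_diff :: "complex poly mat \<Rightarrow> complex poly mat" where
  "bwd_diff P = map_mat (\<lambda>q. q - pcompose q [:-1, 1:]) P"

text \<open>The triple \<open>(F, K, G)\<close> stands for the operator with leading parts \<open>\<Delta> F(x)\<close>, \<open>\<nabla> G(x)\<close> and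
  zeroth order part \<open>K(x)\<close>, acting from the right.\<close>

definition second_order_operator ::
  "nat \<Rightarrow> complex poly mat \<times> complex poly mat \<times> complex poly mat \<Rightarrow> bool" where
  "second_order_operator m D \<longleftrightarrow> (case D of (F, K, G) \<Rightarrow>
     F \<in> carrier_mat m m \<and> K \<in> carrier_mat m m \<and> G \<in> carrier_mat m m \<and>
     F \<noteq> 0\<^sub>m m m \<and> G \<noteq> 0\<^sub>m m m)"

definition diff_act ::
  "complex poly mat \<Rightarrow> complex poly mat \<times> complex poly mat \<times> complex poly mat
     \<Rightarrow> complex poly mat" where
  "diff_act P D = (case D of (F, K, G) \<Rightarrow> fwd_diff P * F + P * K + bwd_diff P * G)"

section \<open>The exponential is linear in \<open>x\<close>\<close>

lemma A_mat_carrier [simp]: "A_mat m a \<in> carrier_mat m m"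
  by (simp add: A_mat_def)

lemma A_mat_index_zero:
  assumes "r < m" "s < m" "odd r \<or> even s"
  shows "A_mat m a $$ (r, s) = 0"
proof -
  have "unit_mat m (2*j - 1) (2*j) $$ (r, s) = 0" if "j \<ge> 1" for j
    using that assms by (auto simp: unit_mat_def) presburger+
  moreover have "unit_mat m (2*j + 1) (2*j) $$ (r, s) = 0" for j
    using assms by (auto simp: unit_mat_def) presburger+
  ultimately show ?thesis
    using assms by (simp add: A_mat_def)
qed

lemma A_mat_square: "A_mat m a * A_mat m a = 0\<^sub>m m m"
proof (rule eq_matI)
  fix i j assume ij: "i < dim_row (0\<^sub>m m m :: complex mat)" "j < dim_col (0\<^sub>m m m :: complex mat)"
  have "(A_mat m a * A_mat m a) $$ (i, j) =
      (\<Sum>k\<in>{0..<m}. A_mat m a $$ (i, k) * A_mat m a $$ (k, j))"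
    using ij carrier_matD[OF A_mat_carrier[of m a]] by (simp add: scalar_prod_def)
  also have "\<dots> = 0"
    using ij A_mat_index_zero[of i m _ a] A_mat_index_zero[of _ m j a]
    by (intro sum.neutral) (metis atLeastLessThan_iff index_zero_mat(2,3) mult_eq_0_iff)
  finally show "(A_mat m a * A_mat m a) $$ (i, j) = 0\<^sub>m m m $$ (i, j)" using ij by simp
qed (use carrier_matD[OF A_mat_carrier[of m a]] in auto)

lemma T_mat_eq: "T_mat m a x = 1\<^sub>m m + x \<cdot>\<^sub>m A_mat m a"
proof -
  let ?B = "x \<cdot>\<^sub>m A_mat m a"
  have B: "?B \<in> carrier_mat m m" by simp
  have "?B * ?B = x \<cdot>\<^sub>m (x \<cdot>\<^sub>m (A_mat m a * A_mat m a))"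
    by (simp add: mult_smult_assoc_mat[of _ m m _ m] mult_smult_distrib[of _ m m _ m])
  hence sq: "?B * ?B = 0\<^sub>m m m" by (simp add: A_mat_square)
  have pow: "?B ^\<^sub>m (Suc (Suc k)) = 0\<^sub>m m m" for k
  proof -
    have "?B ^\<^sub>m k \<in> carrier_mat m m" using B by (rule pow_carrier_mat)
    hence "?B ^\<^sub>m (Suc (Suc k)) = ?B ^\<^sub>m k * (?B * ?B)" using B by (simp add: assoc_mult_mat[of _ m m _ m _ m])
    also have "\<dots> = 0\<^sub>m m m"
      unfolding sq using \<open>?B ^\<^sub>m k \<in> carrier_mat m m\<close> by (rule right_mult_zero_mat)
    finally show ?thesis .
  qed
  have "(\<Sum>k. (?B ^\<^sub>m k) $$ (i, j) / fact k) = (1\<^sub>m m + ?B) $$ (i, j)" if "i < m" "j < m" for i j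
  proof -
    have "(?B ^\<^sub>m k) $$ (i, j) / fact k = 0" if "k \<notin> {0, 1}" for k
    proof -
      from that obtain l where "k = Suc (Suc l)" by (cases k; cases "k - 1") auto
      thus ?thesis using pow[of l] \<open>i < m\<close> \<open>j < m\<close> by (simp del: pow_mat.simps)
    qed
    hence "(\<Sum>k. (?B ^\<^sub>m k) $$ (i, j) / fact k) = (\<Sum>k\<in>{0, 1}. (?B ^\<^sub>m k) $$ (i, j) / fact k)"
      by (intro suminf_finite) auto
    also have "\<dots> = (1\<^sub>m m + ?B) $$ (i, j)"
      using that carrier_matD[OF A_mat_carrier[of m a]] left_mult_one_mat[OF B] by simp
    finally show ?thesis .
  qed
  thus ?thesis
    unfolding T_mat_def mat_exp_def
    by (intro eq_matI) (use carrier_matD[OF A_mat_carrier[of m a]] in auto)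
qed

end

theory Submission
  imports Defs
begin

text \<open>Since \<open>A D A = 0\<close> for every diagonal \<open>D\<close>, one has \<open>Q\<^sub>n(x) T(x) = R\<^sub>n(x)\<close> with
  \<open>R\<^sub>n = P\<^sub>n + A P\<^sub>n\<^sub>+\<^sub>1 - \<parallel>P\<^sub>n\<parallel>\<^sup>2 A\<^sup>* \<parallel>P\<^sub>n\<^sub>-\<^sub>1\<parallel>\<^sup>-\<^sup>2 P\<^sub>n\<^sub>-\<^sub>1\<close>, so everything reduces to \<open>R\<^sub>n\<close> and the diagonal weight.
  Each scalar weight satisfies Pearson's equation \<open>w(x) f(x) = w(x+1) g(x+1)\<close> with
  \<open>f = f\<^sub>0 + f\<^sub>1 x + e x\<^sup>2\<close> and \<open>g = g\<^sub>1 x + e x\<^sup>2\<close>, hence its orthogonal polynomials are eigenfunctions of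
  \<open>\<delta> = \<Delta> f - \<nabla> g\<close> with eigenvalues \<open>\<lambda>\<^sub>n = n (f\<^sub>1 - g\<^sub>1) + n (n - 1) e\<close>. An entry of \<open>A\<close> couples degree
  \<open>n\<close> for an odd index to degree \<open>n + 1\<close> for an even one, so \<open>R\<^sub>n\<close> is an eigenfunction of
  \<open>diag(\<delta>\<^sub>i + \<kappa>\<^sub>i)\<close> as soon as the shifted eigenvalues agree at these degrees; this is possible exactly
  when \<open>f\<^sub>1 - g\<^sub>1\<close> differs by \<open>2 e\<close> between odd and even indices. Conjugating by \<open>T\<close>, which is
  polynomial with polynomial inverse, gives the operator for \<open>Q\<^sub>n\<close>.\<close>

section \<open>Second-order difference operators on scalar polynomials\<close>

text \<open>By Taylor expansion q(x + c) - q(x) is c q'(x) plus terms of lower degree. The truncated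
  index n - 1 is harmless at n = 0, where both sides of the second claim are 0.\<close>

lemma diff_shift_top:
  fixes q :: "complex poly"
  assumes "degree q \<le> n"
  shows "\<forall>k\<ge>n. coeff (q \<circ>\<^sub>p [:c, 1:] - q) k = 0"
    and "coeff (q \<circ>\<^sub>p [:c, 1:] - q) (n - 1) = of_nat n * c * coeff q n"
proof -
  have "(\<forall>k\<ge>n. coeff (q \<circ>\<^sub>p [:c, 1:] - q) k = 0) \<and>
        coeff (q \<circ>\<^sub>p [:c, 1:] - q) (n - 1) = of_nat n * c * coeff q n"
    using assms
  proof (induction n arbitrary: q)
    case 0
    then obtain b where "q = [:b:]" by (auto elim: degree_eq_zeroE)
    thus ?case by simp
  next
    case (Suc n)
    obtain b r where q: "q = pCons b r" by (cases q)
    let ?D = "r \<circ>\<^sub>p [:c, 1:] - r"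
    have "degree r \<le> n" using Suc.prems by (cases "r = 0") (auto simp: q)
    hence r: "\<forall>k\<ge>n. coeff ?D k = 0" "coeff ?D (n - 1) = of_nat n * c * coeff r n"
        "\<forall>k>n. coeff r k = 0"
      using Suc.IH[of r] by (auto intro: coeff_eq_0)
    \<comment> \<open>With q = b + x r the difference is (x + c) r(x + c) - x r(x), which regroups
      in terms of the shift difference of r.\<close>
    have D: "q \<circ>\<^sub>p [:c, 1:] - q = smult c (?D + r) + pCons 0 ?D"
      by (simp add: q pcompose_pCons algebra_simps)
    have "coeff (pCons 0 ?D) n = of_nat n * c * coeff r n"
      using r(2) by (cases n) (auto simp del: coeff_diff)
    moreover have "coeff q (Suc n) = coeff r n" by (simp add: q)
    ultimately show ?case using r
      unfolding D coeff_add coeff_smult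
      by (auto simp del: coeff_diff simp: coeff_pCons algebra_simps split: nat.splits)
  qed
  thus "\<forall>k\<ge>n. coeff (q \<circ>\<^sub>p [:c, 1:] - q) k = 0"
    and "coeff (q \<circ>\<^sub>p [:c, 1:] - q) (n - 1) = of_nat n * c * coeff q n" by auto
qed

definition diff_op :: "complex poly \<Rightarrow> complex poly \<Rightarrow> complex poly \<Rightarrow> complex poly" where
  "diff_op f g q = f * (q \<circ>\<^sub>p [:1, 1:] - q) - g * (q - q \<circ>\<^sub>p [:-1, 1:])"

text \<open>The commutator of the operator with multiplication by x: beyond x times the image of q
  there remains f(x) q(x+1) - g(x) q(x-1). It is split into shift differences, which lower the
  degree, and (f - g) q, so that \<open>diff_shift_top\<close> applies to each piece.\<close>

lemma diff_op_pCons: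
  "diff_op f g (pCons b q) =
     pCons 0 (diff_op f g q) + f * (q \<circ>\<^sub>p [:1, 1:] - q) - g * (q \<circ>\<^sub>p [:-1, 1:] - q) + (f - g) * q"
proof -
  \<comment> \<open>A ring identity in which B, X, u, d stand for b, x, q(x+1), q(x-1).\<close>
  have gen: "f * ((B + (X + 1) * u) - (B + X * q)) - g * ((B + X * q) - (B + (X - 1) * d)) =
      X * (f * (u - q) - g * (q - d)) + f * (u - q) - g * (d - q) + (f - g) * q"
    for B X u d :: "complex poly"
    by (simp add: algebra_simps)
  have q: "pCons b q = [:b:] + [:0, 1:] * q" by simp
  have X: "pCons 0 r = [:0, 1:] * r" for r :: "complex poly" by simp
  have lin: "[:1, 1:] = [:0, 1 :: complex:] + 1" "[:-1, 1:] = [:0, 1 :: complex:] - 1"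
    by (rule poly_eqI, simp add: coeff_pCons split: nat.splits)+
  have up: "pCons b q \<circ>\<^sub>p [:1, 1:] = [:b:] + ([:0, 1:] + 1) * (q \<circ>\<^sub>p [:1, 1:])"
    and dn: "pCons b q \<circ>\<^sub>p [:-1, 1:] = [:b:] + ([:0, 1:] - 1) * (q \<circ>\<^sub>p [:-1, 1:])"
    unfolding pcompose_pCons lin by (rule refl)+
  show ?thesis
    unfolding X[of "diff_op f g q"] unfolding diff_op_def up dn unfolding q by (rule gen)
qed

definition eigval :: "complex \<Rightarrow> complex \<Rightarrow> nat \<Rightarrow> complex" where
  "eigval s e n = of_nat n * s + of_nat n * (of_nat n - 1) * e"

lemma coeff_quadratic_mult:
  "coeff ([:b0, b1, b2:] * r) (Suc n) =
     b0 * coeff r (Suc n) + b1 * coeff r n + b2 * (if n = 0 then 0 else coeff r (n - 1))"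
  for b0 :: "'a :: comm_ring_1"
  by (cases n) (simp_all add: algebra_simps)

text \<open>The common coefficient e makes the quadratic parts of f and g combine into e x^2 times a
  second difference, which drops the degree by two and contributes n(n - 1)e; the linear parts
  contribute n(f1 - g1). Hence the operator is triangular on monomials with diagonal
  \<open>eigval\<close>. The induction writes q = b + x r.\<close>

lemma diff_op_top:
  assumes "degree q \<le> n"
  shows "(\<forall>k>n. coeff (diff_op [:f0, f1, e:] [:0, g1, e:] q) k = 0) \<and>
         coeff (diff_op [:f0, f1, e:] [:0, g1, e:] q) n = eigval (f1 - g1) e n * coeff q n"
  using assms
proof (induction n arbitrary: q)
  case 0
  then obtain b where "q = [:b:]" by (auto elim: degree_eq_zeroE)
  thus ?case by (simp add: diff_op_def eigval_def)
next
  case (Suc n)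
  obtain b r where q: "q = pCons b r" by (cases q)
  let ?f = "[:f0, f1, e:]" and ?g = "[:0, g1, e:]"
  let ?D = "r \<circ>\<^sub>p [:1, 1:] - r" and ?D' = "r \<circ>\<^sub>p [:-1, 1:] - r"
  have deg: "degree r \<le> n" using Suc.prems by (cases "r = 0") (auto simp: q)
  note D = diff_shift_top[OF deg, of 1] and D' = diff_shift_top[OF deg, of "-1"]
  have r: "\<forall>k>n. coeff r k = 0" using deg by (auto intro: coeff_eq_0)
  have fg: "?f - ?g = [:f0, f1 - g1, 0:]" by simp
  have exp: "coeff (diff_op ?f ?g q) (Suc k) =
      coeff (diff_op ?f ?g r) k
      + (f0 * coeff ?D (Suc k) + f1 * coeff ?D k + e * (if k = 0 then 0 else coeff ?D (k - 1)))
      - (g1 * coeff ?D' k + e * (if k = 0 then 0 else coeff ?D' (k - 1)))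
      + (f0 * coeff r (Suc k) + (f1 - g1) * coeff r k)" for k
    unfolding q diff_op_pCons fg coeff_add coeff_diff[of _ "?g * _"] coeff_quadratic_mult
    by simp
  have "coeff (diff_op ?f ?g q) k = 0" if "k > Suc n" for k
  proof -
    from that obtain l where l: "k = Suc l" "l > n" by (cases k) auto
    have "coeff ?D l = 0" "coeff ?D (Suc l) = 0" "coeff ?D (l - 1) = 0"
         "coeff ?D' l = 0" "coeff ?D' (l - 1) = 0" "coeff r l = 0" "coeff r (Suc l) = 0"
         "coeff (diff_op ?f ?g r) l = 0"
      using D(1) D'(1) r l Suc.IH[OF deg] by (auto simp del: coeff_diff)
    thus ?thesis unfolding l(1) exp by (simp del: coeff_diff)
  qed
  \<comment> \<open>The two differences together give 2 n e and (f - g) r gives f1 - g1; the sum is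
    the increment of \<open>eigval\<close> from n to n + 1.\<close>
  moreover have "coeff (diff_op ?f ?g q) (Suc n) = eigval (f1 - g1) e (Suc n) * coeff q (Suc n)"
  proof -
    have "coeff ?D n = 0" "coeff ?D (Suc n) = 0" "coeff ?D' n = 0" "coeff r (Suc n) = 0"
      using D(1) D'(1) r by (auto simp del: coeff_diff)
    moreover have "(if n = 0 then 0 else coeff ?D (n - 1)) = of_nat n * coeff r n"
        "(if n = 0 then 0 else coeff ?D' (n - 1)) = - of_nat n * coeff r n"
      using D(2) D'(2) by (auto simp del: coeff_diff)
    moreover have "coeff q (Suc n) = coeff r n" by (simp add: q)
    ultimately show ?thesis
      unfolding exp using Suc.IH[OF deg]
      by (simp del: coeff_diff add: eigval_def algebra_simps)
  qed
  ultimately show ?case by (intro conjI allI impI)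
qed

lemma degree_diff_op_le:
  "degree (diff_op [:f0, f1, e:] [:0, g1, e:] q) \<le> degree q"
  by (rule degree_le) (use diff_op_top[OF order.refl] in blast)

lemma pcompose_shift_cancel:
  "(q \<circ>\<^sub>p [:1, 1:]) \<circ>\<^sub>p [:-1, 1:] = q" "(q \<circ>\<^sub>p [:-1, 1:]) \<circ>\<^sub>p [:1, 1:] = q"
  for q :: "complex poly"
  by (simp_all add: pcompose_assoc[symmetric] pcompose_pCons)

section \<open>Moment functional and Pearson equation\<close>

text \<open>Letting x range over all integers encodes the boundary conditions too: for a weight
  positive exactly on the lattice, g vanishes at 0 and f at the right end point, if there is
  one.\<close>

definition pearson :: "(int \<Rightarrow> real) \<Rightarrow> complex poly \<Rightarrow> complex poly \<Rightarrow> bool" where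
  "pearson w f g \<longleftrightarrow> (\<forall>x::int. complex_of_real (w x) * poly f (of_int x) =
                     complex_of_real (w (x + 1)) * poly g (of_int (x + 1)))"


locale lattice_weight =
  fixes N :: enat and w :: "int \<Rightarrow> real"
  assumes weight: "scalar_weight N w"
begin

lemma weight_pos: "x \<in> lattice N \<Longrightarrow> w x > 0"
  and weight_zero: "x \<notin> lattice N \<Longrightarrow> w x = 0"
  using weight unfolding scalar_weight_def by auto

definition moment :: "complex poly \<Rightarrow> complex" where
  "moment q = (\<Sum>\<^sub>\<infinity>x\<in>lattice N. poly q (of_int x) * complex_of_real (w x))"

lemma moment_summable:
  "(\<lambda>x. poly q (of_int x) * complex_of_real (w x)) summable_on lattice N"
proof -
  have "(\<lambda>x. \<Sum>i\<le>n. coeff q i * complex_of_real (of_int x ^ i * w x)) summable_on lattice N" for n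
  proof (induction n)
    case 0
    have "(\<lambda>x. of_int x ^ 0 * w x) summable_on lattice N"
      using weight unfolding scalar_weight_def by blast
    thus ?case by (auto intro!: summable_on_cmult_right summable_on_of_real)
  next
    case (Suc n)
    have "(\<lambda>x. of_int x ^ Suc n * w x) summable_on lattice N"
      using weight unfolding scalar_weight_def by blast
    hence "(\<lambda>x. coeff q (Suc n) * complex_of_real (of_int x ^ Suc n * w x)) summable_on lattice N"
      by (intro summable_on_cmult_right summable_on_of_real)
    from summable_on_add[OF Suc.IH this] show ?case by simp
  qed
  moreover have "poly q (of_int x) * complex_of_real (w x) =
      (\<Sum>i\<le>degree q. coeff q i * complex_of_real (of_int x ^ i * w x))" for x
    by (simp add: poly_altdef sum_distrib_right mult.assoc)
  ultimately show ?thesis by simp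
qed

lemma moment_has_sum:
  "((\<lambda>x. poly q (of_int x) * complex_of_real (w x)) has_sum moment q) (lattice N)"
  using has_sum_infsum[OF moment_summable] unfolding moment_def .

lemma momentI:
  "((\<lambda>x. poly q (of_int x) * complex_of_real (w x)) has_sum c) (lattice N) \<Longrightarrow> moment q = c"
  unfolding moment_def by (rule infsumI)

lemma moment_add: "moment (q + r) = moment q + moment r"
  by (rule momentI) (use has_sum_add[OF moment_has_sum moment_has_sum, of q r] in
    \<open>simp add: algebra_simps\<close>)

lemma moment_smult: "moment (smult c q) = c * moment q"
  by (rule momentI) (use has_sum_cmult_right[OF moment_has_sum, of c q] in
    \<open>simp add: algebra_simps\<close>)

lemma moment_0 [simp]: "moment 0 = 0"
  using moment_smult[of 0 0] by simp

lemma moment_diff: "moment (q - r) = moment q - moment r"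
  using moment_add[of q "smult (-1) r"] moment_smult[of "-1" r] by simp

lemma moment_cong:
  assumes "\<And>x. x \<in> lattice N \<Longrightarrow> poly q (of_int x) = poly r (of_int x)"
  shows "moment q = moment r"
  unfolding moment_def using assms by (intro infsum_cong) auto

lemma moment_UNIV:
  "moment q = (\<Sum>\<^sub>\<infinity>x. poly q (of_int x) * complex_of_real (w x))"
  unfolding moment_def by (intro infsum_cong_neutral) (auto simp: weight_zero)

text \<open>Summation by substitution. The sum is first extended to all integers, since only there
  is translation by 1 a bijection; Pearson's equation then turns the shifted weight back into the
  weight.\<close>

lemma moment_shift:
  assumes "pearson w f g"
  shows "moment (f * h) = moment (g * (h \<circ>\<^sub>p [:-1, 1:]))"
proof -
  have "moment (g * (h \<circ>\<^sub>p [:-1, 1:])) =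
      (\<Sum>\<^sub>\<infinity>x::int. poly (g * (h \<circ>\<^sub>p [:-1, 1:])) (of_int (x + 1)) * complex_of_real (w (x + 1)))"
    unfolding moment_UNIV
    by (rule infsum_reindex_bij_betw[symmetric]) (rule bij_betwI[of _ _ _ "\<lambda>x. x - 1"], auto)
  also have "\<dots> = moment (f * h)"
    unfolding moment_UNIV
  proof (rule infsum_cong)
    fix x :: int
    show "poly (g * (h \<circ>\<^sub>p [:-1, 1:])) (of_int (x + 1)) * complex_of_real (w (x + 1)) =
          poly (f * h) (of_int x) * complex_of_real (w x)"
      using assms unfolding pearson_def by (simp add: poly_pcompose mult_ac)
  qed
  finally show ?thesis by simp
qed

text \<open>The operator is f(x) q(x+1) + g(x) q(x-1) - (f + g) q. \<open>moment_shift\<close> moves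
  each of the first two parts onto the other factor with f and g exchanged, and the last part is
  symmetric already.\<close>

lemma moment_diff_op:
  assumes "pearson w f g"
  shows "moment (diff_op f g q * r) = moment (q * diff_op f g r)"
proof -
  let ?u = "\<lambda>q. q \<circ>\<^sub>p [:1, 1 :: complex:]" and ?d = "\<lambda>q. q \<circ>\<^sub>p [:-1, 1 :: complex:]"
  have "moment (f * (?u q * r)) = moment (g * (q * ?d r))"
    using moment_shift[OF assms, of "?u q * r"] by (simp add: pcompose_mult pcompose_shift_cancel)
  moreover have "moment (f * (q * ?u r)) = moment (g * (?d q * r))"
    using moment_shift[OF assms, of "q * ?u r"] by (simp add: pcompose_mult pcompose_shift_cancel)
  moreover have "diff_op f g q * r = f * (?u q * r) + g * (?d q * r) - (f + g) * (q * r)"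
      "q * diff_op f g r = f * (q * ?u r) + g * (q * ?d r) - (f + g) * (q * r)"
    by (simp_all add: diff_op_def algebra_simps)
  ultimately show ?thesis by (simp only: moment_add moment_diff add.commute)
qed

section \<open>The Hermitian product and its definiteness\<close>

text \<open>At real points, conjugating the coefficients conjugates the value, so the Hermitian
  product of two polynomials is the moment of a polynomial.\<close>

lemma poly_cnj_self_weight:
  "poly (q * map_poly cnj q) (of_int x) * complex_of_real (w x) =
     complex_of_real ((cmod (poly q (of_int x)))\<^sup>2 * w x)"
  by (simp add: complex_norm_square[symmetric] flip: of_real_power)

lemma sqnorm_summable: "(\<lambda>x. (cmod (poly q (of_int x)))\<^sup>2 * w x) summable_on lattice N"
proof -
  have "(\<lambda>x. Re (complex_of_real ((cmod (poly q (of_int x)))\<^sup>2 * w x))) summable_on lattice N"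
    using moment_summable[of "q * map_poly cnj q"] unfolding poly_cnj_self_weight
    by (rule summable_on_Re)
  thus ?thesis by simp
qed

lemma moment_cnj_self: "moment (q * map_poly cnj q) = complex_of_real (sqnorm N w q)"
  unfolding sqnorm_def
  by (rule momentI, unfold poly_cnj_self_weight)
     (intro has_sum_of_real has_sum_infsum sqnorm_summable)

text \<open>A degree in \<open>degrees N\<close> guarantees that the points 0, ...,
  \<open>degree q\<close> all lie in the lattice, one more than q can have as roots.\<close>

lemma poly_eq_0_on_lattice:
  fixes q :: "complex poly"
  assumes "\<And>x. x \<in> lattice N \<Longrightarrow> poly q (of_int x) = 0" "degree q \<in> degrees N"
  shows "q = 0"
proof (rule poly_eqI_degree[where A = "of_nat ` {..degree q}"])
  show "poly q x = poly 0 x" if "x \<in> of_nat ` {..degree q}" for x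
  proof -
    from that obtain k where k: "x = of_nat k" "k \<le> degree q" by auto
    have "enat k \<le> enat (degree q)" using k by simp
    also have "\<dots> \<le> N" using assms(2) by (simp add: degrees_def)
    finally have "int k \<in> lattice N" by (simp add: lattice_def)
    from assms(1)[OF this] show ?thesis by (simp add: k)
  qed
qed (auto simp: card_image)

lemma sqnorm_pos:
  assumes "q \<noteq> 0" "degree q \<in> degrees N"
  shows "sqnorm N w q > 0"
proof (rule ccontr)
  let ?h = "\<lambda>x. (cmod (poly q (of_int x)))\<^sup>2 * w x"
  assume "\<not> sqnorm N w q > 0"
  moreover have nn: "?h x \<ge> 0" if "x \<in> lattice N" for x using weight_pos[OF that] by simp
  ultimately have le: "infsum ?h (lattice N) \<le> 0" unfolding sqnorm_def by simp
  have "poly q (of_int x) = 0" if x: "x \<in> lattice N" for x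
    using nonneg_infsum_le_0D[OF le sqnorm_summable nn x] weight_pos[OF x] by simp
  with assms poly_eq_0_on_lattice show False by blast
qed

end

section \<open>Orthogonal polynomials of a single weight and their difference equation\<close>

locale lattice_orthogonal = lattice_weight +
  fixes p :: "nat \<Rightarrow> complex poly"
  assumes orth: "monic_orthogonal N w p"
begin

lemma degree_p: "n \<in> degrees N \<Longrightarrow> degree (p n) = n"
  and monic_p: "n \<in> degrees N \<Longrightarrow> coeff (p n) n = 1"
  using orth unfolding monic_orthogonal_def by force+

lemma p_last_zero:
  assumes "Suc n \<notin> degrees N" "n \<in> degrees N" "x \<in> lattice N"
  shows "poly (p (Suc n)) (of_int x) = 0"
proof -
  obtain M where M: "N = enat M" "n = M"
    using assms by (cases N) (auto simp: degrees_def)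
  hence x: "nat x \<in> {0..M}" "0 \<le> x" using assms(3) by (auto simp: lattice_def)
  have "p (Suc M) = (\<Prod>y\<in>{0..M}. [:- of_nat y, 1:])"
    using orth M unfolding monic_orthogonal_def by auto
  hence "poly (p (Suc n)) (of_int x) = (\<Prod>y\<in>{0..M}. of_int x - of_nat y)"
    by (simp add: M poly_prod)
  also have "\<dots> = 0" using x by (intro prod_zero bexI[of _ "nat x"]) auto
  finally show ?thesis .
qed

lemma degree_p_Suc: 
  assumes "n \<in> degrees N"
  shows "degree (p (Suc n)) = Suc n" "coeff (p (Suc n)) (Suc n) = 1"
proof -
  have "degree (p (Suc n)) = Suc n \<and> lead_coeff (p (Suc n)) = 1"
  proof (cases "Suc n \<in> degrees N")
    case True
    thus ?thesis using degree_p monic_p by simp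
  next
    case False
    then obtain M where M: "N = enat M" "n = M"
      using assms by (cases N) (auto simp: degrees_def)
    have eq: "p (Suc n) = (\<Prod>y\<in>{0..M}. [:- of_nat y, 1:])"
      using orth M unfolding monic_orthogonal_def by auto
    show ?thesis unfolding eq
      using degree_prod_eq_sum_degree[of "{0..M}" "\<lambda>y. [:- of_nat y, 1 :: complex:]"]
        lead_coeff_prod[of "\<lambda>y. [:- of_nat y, 1 :: complex:]" "{0..M}"] by (simp add: M)
  qed
  thus "degree (p (Suc n)) = Suc n" "coeff (p (Suc n)) (Suc n) = 1" by auto
qed

text \<open>The indices may exceed the last degree of a finite lattice by one: the polynomial there
  vanishes on the whole lattice, so its products have moment 0. This covers the term of degree n + 1
  in \<open>R_mat\<close>.\<close>

lemma moment_p_p: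
  assumes "n \<in> degrees N \<or> (\<exists>l\<in>degrees N. n = Suc l)" "k \<in> degrees N \<or> (\<exists>l\<in>degrees N. k = Suc l)"
  shows "moment (p n * map_poly cnj (p k)) =
           (if n = k then complex_of_real (sqnorm N w (p n)) else 0)"
proof (cases "n = k")
  case True
  thus ?thesis by (simp add: moment_cnj_self)
next
  case False
  show ?thesis
  proof (cases "n \<in> degrees N \<and> k \<in> degrees N")
    case True
    with False have "((\<lambda>x. poly (p n) (of_int x) * cnj (poly (p k) (of_int x)) * complex_of_real (w x))
           has_sum 0) (lattice N)"
      using orth unfolding monic_orthogonal_def by blast
    hence "moment (p n * map_poly cnj (p k)) = 0" by (intro momentI) simp
    with False show ?thesis by simp
  next
    case *: False
    have "poly (p n * map_poly cnj (p k)) (of_int x) = poly 0 (of_int x)" if "x \<in> lattice N" for x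
      using * assms that p_last_zero by auto
    from moment_cong[OF this] False show ?thesis by simp
  qed
qed

text \<open>Strong induction on the degree of q: its leading term is removed by a multiple of a
  conjugated orthogonal polynomial, which is monic of the same degree and has moment 0 against p
  n.\<close>

lemma moment_p_lower:
  assumes "n \<in> degrees N" "degree q < n"
  shows "moment (p n * q) = 0"
  using assms(2)
proof (induction "degree q" arbitrary: q rule: less_induct)
  case less
  define k where "k = degree q"
  define r where "r = q - smult (lead_coeff q) (map_poly cnj (p k))"
  have k: "k \<in> degrees N" "k < n"
    using assms(1) less.prems by (auto simp: k_def degrees_def intro: order.trans[of _ "enat n"])
  have dk: "degree (map_poly cnj (p k)) = k"
    using degree_p[OF k(1)] by (simp add: Polynomial.degree_map_poly)
  have ck: "coeff r k = 0" using monic_p[OF k(1)] by (simp add: r_def coeff_map_poly k_def)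
  have "degree r \<le> k" unfolding r_def
    by (intro degree_diff_le) (auto simp: k_def[symmetric] dk intro: order.trans[OF degree_smult_le])
  have "moment (p n * r) = 0"
  proof (cases "r = 0")
    case False
    hence "degree r < k" using ck \<open>degree r \<le> k\<close> by (metis le_neq_implies_less leading_coeff_0_iff)
    thus ?thesis using less k by (simp add: k_def)
  qed simp
  moreover have "moment (p n * map_poly cnj (p k)) = 0"
    using moment_p_p[of n k] assms k by auto
  moreover have "p n * q = p n * r + smult (lead_coeff q) (p n * map_poly cnj (p k))"
    by (simp add: r_def algebra_simps)
  ultimately show ?case by (simp add: moment_add moment_smult)
qed

text \<open>The defect r has degree below n because the top coefficients match. Paired with its own
  conjugate, symmetry moves the operator onto that conjugate, whose image still has degree below n;
  both moments vanish, so r has norm 0.\<close>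

lemma diff_op_p:
  assumes pearson: "pearson w [:f0, f1, e:] [:0, g1, e:]"
    and n: "n \<in> degrees N"
  shows "diff_op [:f0, f1, e:] [:0, g1, e:] (p n) = smult (eigval (f1 - g1) e n) (p n)"
proof -
  let ?\<delta> = "diff_op [:f0, f1, e:] [:0, g1, e:]"
  define r where "r = ?\<delta> (p n) - smult (eigval (f1 - g1) e n) (p n)"
  have top: "coeff r k = 0" if "k \<ge> n" for k
  proof (cases "k = n")
    case True
    thus ?thesis using diff_op_top[of "p n" n f0 f1 e g1] degree_p[OF n] by (simp add: r_def)
  next
    case False
    thus ?thesis using diff_op_top[of "p n" n f0 f1 e g1] degree_p[OF n] that
      by (simp add: r_def coeff_eq_0)
  qed
  have "r = 0"
  proof (rule ccontr)
    assume "r \<noteq> 0"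
    hence "degree r < n" using top[of "degree r"] by (meson leading_coeff_0_iff not_le)
    let ?c = "map_poly cnj r"
    have c: "degree ?c < n" using \<open>degree r < n\<close> by (simp add: Polynomial.degree_map_poly)
    have "moment (r * ?c) = moment (?\<delta> (p n) * ?c) - eigval (f1 - g1) e n * moment (p n * ?c)"
      by (simp add: r_def algebra_simps moment_diff moment_smult)
    also have "moment (?\<delta> (p n) * ?c) = moment (p n * ?\<delta> ?c)"
      by (rule moment_diff_op[OF pearson])
    also have "\<dots> = 0"
      using degree_diff_op_le[of f0 f1 e g1 ?c] c by (intro moment_p_lower[OF n]) linarith
    also have "moment (p n * ?c) = 0" by (rule moment_p_lower[OF n c])
    finally have "sqnorm N w r = 0" by (simp add: moment_cnj_self)
    moreover have "degree r \<in> degrees N"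
      using n \<open>degree r < n\<close> by (auto simp: degrees_def intro: order.trans[of _ "enat n"])
    ultimately show False using sqnorm_pos[OF \<open>r \<noteq> 0\<close>] by simp
  qed
  thus ?thesis by (simp add: r_def)
qed

text \<open>Beyond the last orthogonal polynomial on a finite lattice, the eigenvalue equation holds
  because Pearson's equation forces the forward coefficient to vanish at the right end point, so
  that the operator preserves the polynomials vanishing on the lattice.\<close>

lemma diff_op_p_Suc:
  assumes pearson: "pearson w [:f0, f1, e:] [:0, g1, e:]"
    and n: "n \<in> degrees N"
  shows "diff_op [:f0, f1, e:] [:0, g1, e:] (p (Suc n)) =
           smult (eigval (f1 - g1) e (Suc n)) (p (Suc n))"
proof (cases "Suc n \<in> degrees N")
  case True
  thus ?thesis by (rule diff_op_p[OF pearson])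
next
  case False
  let ?f = "[:f0, f1, e:]" and ?g = "[:0, g1, e:]"
  define r where "r = diff_op ?f ?g (p (Suc n)) - smult (eigval (f1 - g1) e (Suc n)) (p (Suc n))"
  note deg = degree_p_Suc[OF n]
  have "coeff r k = 0" if "k > n" for k
    using diff_op_top[of "p (Suc n)" "Suc n" f0 f1 e g1] deg that
    by (cases "k = Suc n") (auto simp: r_def coeff_eq_0)
  hence "degree r \<le> n" by (intro degree_le) auto
  \<comment> \<open>Here n is the right end point, so vanishing at the n + 1 lattice points will
    force r = 0.\<close>
  have "poly r (of_int x) = 0" if x: "x \<in> lattice N" for x
  proof -
    have z: "poly (p (Suc n)) (of_int y) = 0" if "y \<in> lattice N" for y
      using p_last_zero[OF False n that] .
    have "poly ?f (of_int x) * poly (p (Suc n)) (of_int (x + 1)) = 0"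
    proof (cases "x + 1 \<in> lattice N")
      case False
      hence "poly ?f (of_int x) = 0" using pearson[unfolded pearson_def, rule_format, of x] weight_zero[OF False] weight_pos[OF x] by simp
      thus ?thesis by simp
    qed (simp only: z mult_zero_right)
    moreover have "poly ?g (of_int x) * poly (p (Suc n)) (of_int (x - 1)) = 0"
    proof (cases "x - 1 \<in> lattice N")
      case False
      hence "poly ?g (of_int x) = 0"
        using pearson[unfolded pearson_def, rule_format, of "x - 1"] weight_zero[OF False] weight_pos[OF x] by simp
      thus ?thesis by simp
    qed (simp only: z mult_zero_right)
    ultimately show ?thesis using z[OF x]
      unfolding r_def diff_op_def poly_diff poly_mult poly_smult poly_pcompose
      by (simp add: algebra_simps del: poly_pCons) (auto simp: poly_pCons add.commute)
  qed
  moreover have "degree r \<in> degrees N"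
    using n \<open>degree r \<le> n\<close> by (auto simp: degrees_def intro: order.trans[of _ "enat n"])
  ultimately have "r = 0" by (rule poly_eq_0_on_lattice)
  thus ?thesis by (simp add: r_def)
qed

end

section \<open>Pearson equations of the classical families\<close>

text \<open>Below 0 both weights vanish, except at x = -1, where w(0) meets the factor x + 1 = 0;
  this is why g has no constant term.\<close>

lemma pearsonI:
  fixes f0 f1 e g1 :: real
  assumes neg: "\<And>x. x < 0 \<Longrightarrow> w x = 0"
    and step: "\<And>n::nat. w (int n) * (f0 + f1 * real n + e * (real n)\<^sup>2) =
             w (int (Suc n)) * (real (Suc n) * (g1 + e * real (Suc n)))"
  shows "pearson w [:complex_of_real f0, of_real f1, of_real e:] [:0, of_real g1, of_real e:]"
proof -
  have "w x * (f0 + f1 * x + e * (real_of_int x)\<^sup>2) = w (x + 1) * ((x + 1) * (g1 + e * (x + 1)))" for x :: int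
  proof (cases "x \<ge> 0")
    case True
    thus ?thesis using step[of "nat x"] by (simp add: algebra_simps)
  next
    case False
    thus ?thesis using neg[of x] neg[of "x + 1"] by (cases "x = -1") auto
  qed
  hence "complex_of_real (w x * (f0 + f1 * x + e * (real_of_int x)\<^sup>2)) =
         complex_of_real (w (x + 1) * ((x + 1) * (g1 + e * (x + 1))))" for x :: int by simp
  thus ?thesis
    unfolding pearson_def by (simp add: algebra_simps power2_eq_square)
qed

lemma pearson_charlier:
  "pearson (charlier_weight b) [:complex_of_real b, of_real 0, of_real 0:] [:0, of_real 1, of_real 0:]"
  by (rule pearsonI) (auto simp: charlier_weight_def lattice_def field_simps simp del: of_nat_Suc)

text \<open>The ratio w(x+1)/w(x) = c(\<beta> + x)/(x + 1) fixes f and g up to a common factor. The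
  factor 1/(1 - c) is chosen so that f1 - g1 = -1, as for the Charlier weights.\<close>

lemma pearson_meixner:
  assumes "c < 1"
  shows "pearson (meixner_weight \<beta> c)
           [:complex_of_real (c * \<beta> / (1 - c)), of_real (c / (1 - c)), of_real 0:]
           [:0, of_real (1 / (1 - c)), of_real 0:]"
proof (rule pearsonI)
  fix n :: nat
  have "meixner_weight \<beta> c (int (Suc n)) * real (Suc n) = meixner_weight \<beta> c (int n) * (c * (\<beta> + n))"
    by (simp add: meixner_weight_def lattice_def pochhammer_Suc nat_add_distrib divide_simps
      del: of_nat_Suc)
  thus "meixner_weight \<beta> c (int n) * (c * \<beta> / (1 - c) + c / (1 - c) * real n + 0 * (real n)\<^sup>2) =
        meixner_weight \<beta> c (int (Suc n)) * (real (Suc n) * (1 / (1 - c) + 0 * real (Suc n)))"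
    using assms by (simp add: divide_simps del: of_nat_Suc) (simp add: algebra_simps)
qed (simp add: meixner_weight_def lattice_def)

text \<open>Here f = q(M - x) and g = (1 - q)x, again with f1 - g1 = -1.\<close>

lemma pearson_krawtchouk:
  "pearson (krawtchouk_weight M q)
     [:complex_of_real (q * M), of_real (- q), of_real 0:] [:0, of_real (1 - q), of_real 0:]"
proof (rule pearsonI)
  fix n :: nat
  let ?w = "krawtchouk_weight M q"
  have "?w (int (Suc n)) * real (Suc n) * (1 - q) = ?w (int n) * (q * (real M - real n))"
  \<comment> \<open>For n = M the weight at n + 1 and the factor M - n vanish; beyond M both weights
    are 0.\<close>
  proof (cases "n < M")
    case True
    define k where "k = M - Suc n"
    have M: "M - n = Suc k" "M - Suc n = k" "int (Suc n) \<in> lattice (enat M)"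
        "int n \<in> lattice (enat M)"
      using True by (auto simp: k_def lattice_def)
    have "Suc n * (M choose Suc n) = (M - n) * (M choose n)"
      by (simp only: binomial_absorption binomial_absorb_comp)
    hence *: "real (Suc n) * real (M choose Suc n) = (real M - real n) * real (M choose n)"
      using True by (metis less_imp_le_nat of_nat_diff of_nat_mult)
    have "?w (int (Suc n)) * real (Suc n) * (1 - q) =
        (real (Suc n) * real (M choose Suc n)) * (q ^ Suc n * (1 - q) ^ k * (1 - q))"
      using M unfolding krawtchouk_weight_def nat_int by simp
    also have "\<dots> = ?w (int n) * (q * (real M - real n))"
      unfolding * using M unfolding krawtchouk_weight_def nat_int by simp
    finally show ?thesis .
  qed (auto simp: krawtchouk_weight_def lattice_def)
  thus "?w (int n) * (q * M + - q * real n + 0 * (real n)\<^sup>2) =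
        ?w (int (Suc n)) * (real (Suc n) * (1 - q + 0 * real (Suc n)))"
    by (simp add: algebra_simps)
qed (simp add: krawtchouk_weight_def lattice_def)

lemma binom_shift_Suc: "binom_shift \<alpha> (Suc n) * real (Suc n) = binom_shift \<alpha> n * (\<alpha> + 1 + n)"
  by (simp add: binom_shift_def pochhammer_Suc divide_simps del: of_nat_Suc)

text \<open>Here f = (\<alpha> + 1 + x)(M - x) and g = x(\<beta> + M + 1 - x), so e = -1 and f1 - g1
  = -(\<alpha> + \<beta> + 2).\<close>

lemma pearson_hahn:
  "pearson (hahn_weight M \<alpha> \<beta>)
     [:complex_of_real ((\<alpha> + 1) * M), of_real (M - \<alpha> - 1), of_real (-1):]
     [:0, of_real (\<beta> + M + 1), of_real (-1):]"
proof (rule pearsonI)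
  fix n :: nat
  let ?w = "hahn_weight M \<alpha> \<beta>"
  have "?w (int (Suc n)) * real (Suc n) * (\<beta> + M - n) =
        ?w (int n) * ((\<alpha> + 1 + n) * (real M - real n))"
  proof (cases "n < M")
    case True
    define k where "k = M - Suc n"
    have M: "M - n = Suc k" "M - Suc n = k" "int (Suc n) \<in> lattice (enat M)"
        "int n \<in> lattice (enat M)" "real M - real n = real (Suc k)"
      using True by (auto simp: k_def lattice_def)
    have "?w (int n) * ((\<alpha> + 1 + n) * (real M - real n)) =
          (binom_shift \<alpha> n * (\<alpha> + 1 + n)) * (binom_shift \<beta> (Suc k) * real (Suc k))"
      using M unfolding hahn_weight_def nat_int by simp
    also have "\<dots> = (binom_shift \<alpha> (Suc n) * real (Suc n)) * (binom_shift \<beta> k * (\<beta> + 1 + k))"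
      unfolding binom_shift_Suc[of \<beta> k] binom_shift_Suc[of \<alpha> n] ..
    also have "\<dots> = ?w (int (Suc n)) * real (Suc n) * (\<beta> + 1 + k)"
      using M unfolding hahn_weight_def nat_int by simp
    also have "\<beta> + 1 + k = \<beta> + M - n" using M(5) by simp
    finally show ?thesis by simp
  qed (auto simp: hahn_weight_def lattice_def)
  thus "?w (int n) * ((\<alpha> + 1) * M + (M - \<alpha> - 1) * real n + -1 * (real n)\<^sup>2) =
        ?w (int (Suc n)) * (real (Suc n) * (\<beta> + M + 1 + -1 * real (Suc n)))"
    by (simp add: algebra_simps power2_eq_square)
qed (simp add: hahn_weight_def lattice_def)

text \<open>The Charlier, Meixner and Krawtchouk weights have e = 0 and are all normalised to f1 -
  g1 = -1, so the parity condition is automatic and Charlier and Meixner weights mix freely. For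
  Hahn weights it is the hypothesis on \<alpha> + \<beta>.\<close>

lemma pearson_families:
  assumes "N = \<infinity> \<and>
           ((\<forall>i\<in>{1..m}. charlier_type (w i)) \<or>
            (\<forall>i\<in>{1..m}. meixner_type (w i)) \<or>
            (\<forall>i\<in>{1..m}. charlier_type (w i) \<or> meixner_type (w i))) \<or>
         (\<exists>M::nat. M \<ge> 1 \<and> N = enat M \<and>
           ((\<forall>i\<in>{1..m}. krawtchouk_type M (w i)) \<or> hahn_family M m w))"
  obtains f0 f1 g1 :: "nat \<Rightarrow> complex" and e :: complex
  where "\<And>i. i \<in> {1..m} \<Longrightarrow> pearson (w i) [:f0 i, f1 i, e:] [:0, g1 i, e:]"
    and "\<And>i. i \<in> {1..m} \<Longrightarrow> [:f0 i, f1 i, e:] \<noteq> 0 \<and> [:0, g1 i, e:] \<noteq> 0"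
    and "\<And>i j. i \<in> {1..m} \<Longrightarrow> j \<in> {1..m} \<Longrightarrow> odd i \<Longrightarrow> even j \<Longrightarrow>
           f1 i - g1 i = f1 j - g1 j + 2 * e"
proof -
  consider (lin) "\<forall>i\<in>{1..m}. charlier_type (w i) \<or> meixner_type (w i) \<or>
                    (\<exists>M\<ge>1. krawtchouk_type M (w i))"
    | (hahn) M where "M \<ge> 1" "hahn_family M m w"
    using assms by blast
  thus thesis
  proof cases
    case lin
    have "\<exists>f0 f1 g1. pearson (w i) [:f0, f1, 0:] [:0, g1, 0:] \<and> [:f0, f1, 0:] \<noteq> 0 \<and>
            [:0, g1, 0:] \<noteq> 0 \<and> f1 - g1 = -1" if "i \<in> {1..m}" for i
    proof -
      from lin that consider "charlier_type (w i)" | "meixner_type (w i)"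
        | M where "M \<ge> 1" "krawtchouk_type M (w i)" by blast
      thus ?thesis
      proof cases
        case 1
        then obtain b where "b > 0" "w i = charlier_weight b" by (auto simp: charlier_type_def)
        thus ?thesis using pearson_charlier[of b]
          by (intro exI[of _ "complex_of_real b"] exI[of _ 0] exI[of _ 1]) simp
      next
        case 2
        then obtain \<beta> c where *: "\<beta> > 0" "0 < c" "c < 1" "w i = meixner_weight \<beta> c"
          by (auto simp: meixner_type_def)
        have "complex_of_real (c / (1 - c)) - of_real (1 / (1 - c)) = of_real (-1)"
          unfolding of_real_diff[symmetric] using *(3) by (intro arg_cong[of _ _ of_real]) (simp add: divide_simps)
        with * pearson_meixner[of c \<beta>] show ?thesis
          by (intro exI[of _ "complex_of_real (c * \<beta> / (1 - c))"] exI[of _ "complex_of_real (c / (1 - c))"]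
             exI[of _ "complex_of_real (1 / (1 - c))"]) auto
      next
        case 3
        then obtain q where *: "0 < q" "q < 1" "w i = krawtchouk_weight M q"
          by (auto simp: krawtchouk_type_def)
        with pearson_krawtchouk[of M q] show ?thesis
          by (intro exI[of _ "complex_of_real (q * M)"] exI[of _ "complex_of_real (-q)"]
             exI[of _ "complex_of_real (1 - q)"]) (auto simp: complex_eq_iff)
      qed
    qed
    then obtain f0 f1 g1 where "\<forall>i\<in>{1..m}. pearson (w i) [:f0 i, f1 i, 0:] [:0, g1 i, 0:] \<and>
        [:f0 i, f1 i, 0:] \<noteq> 0 \<and> [:0, g1 i, 0:] \<noteq> 0 \<and> f1 i - g1 i = -1"
      by metis
    thus thesis by (intro that[of f0 f1 0 g1]) auto
  next
    case hahn
    then obtain \<alpha> \<beta> where *: "\<forall>i\<in>{1..m}. w i = hahn_weight M (\<alpha> i) (\<beta> i)"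
        "\<forall>i\<in>{1..m}. \<forall>j\<in>{1..m}. odd i \<and> even j \<longrightarrow> \<alpha> i + \<beta> i = \<alpha> j + \<beta> j + 2"
      unfolding hahn_family_def by blast
    show thesis
    proof (rule that[of "\<lambda>i. of_real ((\<alpha> i + 1) * M)" "\<lambda>i. of_real (M - \<alpha> i - 1)" "of_real (-1)"
          "\<lambda>i. of_real (\<beta> i + M + 1)"])
      show "complex_of_real (M - \<alpha> i - 1) - of_real (\<beta> i + M + 1) =
            of_real (M - \<alpha> j - 1) - of_real (\<beta> j + M + 1) + 2 * of_real (-1)"
        if "i \<in> {1..m}" "j \<in> {1..m}" "odd i" "even j" for i j
      proof -
        have "\<alpha> i + \<beta> i = \<alpha> j + \<beta> j + 2" using *(2) that by blast
        thus ?thesis by (simp add: complex_eq_iff)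
      qed
    qed (use *(1) pearson_hahn in auto)
  qed
qed

section \<open>Matrix preliminaries\<close>

lemma mult_mat_index_sum:
  assumes "A \<in> carrier_mat m m" "B \<in> carrier_mat m m" "i < m" "j < m"
  shows "(A * B) $$ (i, j) = (\<Sum>k<m. A $$ (i, k) * B $$ (k, j))"
  using assms by (simp add: scalar_prod_def atLeast0LessThan)

lemma mat_adjoint_carrier: "A \<in> carrier_mat m n \<Longrightarrow> mat_adjoint A \<in> carrier_mat n m"
  by (auto simp: mat_adjoint_def intro: carrier_matI)

lemma mat_adjoint_index:
  "A \<in> carrier_mat m n \<Longrightarrow> i < n \<Longrightarrow> j < m \<Longrightarrow> mat_adjoint A $$ (i, j) = cnj (A $$ (j, i))"
  by (simp add: mat_adjoint_def mat_of_rows_def conjugate_vec_def)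

lemma mat_adjoint_mult:
  fixes A B :: "complex mat"
  assumes "A \<in> carrier_mat m m" "B \<in> carrier_mat m m"
  shows "mat_adjoint (A * B) = mat_adjoint B * mat_adjoint A"
proof (rule eq_matI)
  have c: "A * B \<in> carrier_mat m m" "mat_adjoint A \<in> carrier_mat m m" "mat_adjoint B \<in> carrier_mat m m"
    using assms by (auto intro: mat_adjoint_carrier)
  show "dim_row (mat_adjoint (A * B)) = dim_row (mat_adjoint B * mat_adjoint A)"
    "dim_col (mat_adjoint (A * B)) = dim_col (mat_adjoint B * mat_adjoint A)"
    using c mat_adjoint_carrier[OF c(1)] by auto
  fix i j assume "i < dim_row (mat_adjoint B * mat_adjoint A)" "j < dim_col (mat_adjoint B * mat_adjoint A)"
  hence ij: "i < m" "j < m" using c by auto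
  have "mat_adjoint (A * B) $$ (i, j) = (\<Sum>k<m. cnj (A $$ (j, k)) * cnj (B $$ (k, i)))"
    unfolding mat_adjoint_index[OF c(1) ij] mult_mat_index_sum[OF assms ij(2,1)] by simp
  also have "\<dots> = (mat_adjoint B * mat_adjoint A) $$ (i, j)"
    unfolding mult_mat_index_sum[OF c(3,2) ij] using ij assms
    by (intro sum.cong) (auto simp: mat_adjoint_index mult.commute)
  finally show "mat_adjoint (A * B) $$ (i, j) = (mat_adjoint B * mat_adjoint A) $$ (i, j)" .
qed

lemma map_mat_pcompose_mult:
  fixes A B :: "complex poly mat"
  assumes "A \<in> carrier_mat m m" "B \<in> carrier_mat m m"
  shows "map_mat (\<lambda>q. q \<circ>\<^sub>p r) (A * B) = map_mat (\<lambda>q. q \<circ>\<^sub>p r) A * map_mat (\<lambda>q. q \<circ>\<^sub>p r) B"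
  by (rule eq_matI)
     (use assms in \<open>auto simp: scalar_prod_def pcompose_sum pcompose_mult intro!: sum.cong\<close>)

lemma eval_mat_mult:
  assumes "A \<in> carrier_mat m m" "B \<in> carrier_mat m m"
  shows "eval_mat (A * B) x = eval_mat A x * eval_mat B x"
  unfolding eval_mat_def
  by (rule eq_matI) (use assms in \<open>auto simp: scalar_prod_def poly_sum intro!: sum.cong\<close>)

lemma mult_minus_distrib_square_mat:
  fixes A :: "'a :: ring mat"
  assumes "A \<in> carrier_mat m m" "B \<in> carrier_mat m m" "C \<in> carrier_mat m m"
  shows "A * (B - C) = A * B - A * C"
  by (rule eq_matI)
     (use assms in \<open>auto simp: scalar_prod_def algebra_simps simp flip: sum_subtractf intro!: sum.cong\<close>)

text \<open>Since (Q T)(x + 1) = Q(x + 1) U(x), and likewise V for x - 1, the operator (F, K, G) on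
  Q T becomes one on Q with leading parts U F and V G. All remaining multiples of Q(x) are collected
  in the zeroth order part.\<close>

lemma diff_act_conjugate:
  fixes Q T T' F K G :: "complex poly mat"
  assumes c: "Q \<in> carrier_mat m m" "T \<in> carrier_mat m m" "T' \<in> carrier_mat m m"
      "F \<in> carrier_mat m m" "K \<in> carrier_mat m m" "G \<in> carrier_mat m m"
  defines "U \<equiv> map_mat (\<lambda>q. q \<circ>\<^sub>p [:1, 1:]) T" and "V \<equiv> map_mat (\<lambda>q. q \<circ>\<^sub>p [:-1, 1:]) T"
  shows "diff_act Q (U * F * T', ((U - T) * F + T * K + (T - V) * G) * T', V * G * T') =
         diff_act (Q * T) (F, K, G) * T'"
proof -
  define q1 where "q1 = map_mat (\<lambda>q. q \<circ>\<^sub>p [:1, 1:]) Q"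
  define q2 where "q2 = map_mat (\<lambda>q. q \<circ>\<^sub>p [:-1, 1:]) Q"
  have [simp]: "U \<in> carrier_mat m m" "V \<in> carrier_mat m m" "q1 \<in> carrier_mat m m" "q2 \<in> carrier_mat m m"
    using c by (auto simp: U_def V_def q1_def q2_def)
  note [simp] = c and dist = add_mult_distrib_mat[of _ m m _ _ m] minus_mult_distrib_mat[of _ m m _ _ m]
    mult_add_distrib_mat[of _ m m _ m] mult_minus_distrib_square_mat[of _ m]
    and assoc = assoc_mult_mat[of _ m m _ m _ m] and [simp] = mult_carrier_mat[of _ m m _ m]
    add_carrier_mat[of _ m m] minus_carrier_mat[of _ m m]
  have fwd: "fwd_diff Q = q1 - Q" "fwd_diff (Q * T) = q1 * U - Q * T"
    and bwd: "bwd_diff Q = Q - q2" "bwd_diff (Q * T) = Q * T - q2 * V"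
    unfolding q1_def q2_def U_def V_def map_mat_pcompose_mult[OF c(1,2), symmetric]
    using c by (auto simp: fwd_diff_def bwd_diff_def intro!: eq_matI)
  have "diff_act Q (U * F * T', ((U - T) * F + T * K + (T - V) * G) * T', V * G * T') =
      ((q1 - Q) * (U * F) + Q * ((U - T) * F + T * K + (T - V) * G) + (Q - q2) * (V * G)) * T'"
    unfolding diff_act_def split fwd bwd by (simp add: dist(1) assoc)
  also have "(q1 - Q) * (U * F) + Q * ((U - T) * F + T * K + (T - V) * G) + (Q - q2) * (V * G) =
      (q1 * (U * F) - Q * (U * F)) + ((Q * (U * F) - Q * (T * F)) + Q * (T * K) + (Q * (T * G) - Q * (V * G)))
      + (Q * (V * G) - q2 * (V * G))"
    by (simp add: dist assoc)
  also have "\<dots> = (q1 * (U * F) - Q * (T * F)) + Q * (T * K) + (Q * (T * G) - q2 * (V * G))"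
  proof -
    \<comment> \<open>The terms Q U F and Q V G cancel; this is checked entrywise, matrices forming
      a group only within a fixed carrier.\<close>
    have "(A - B) + ((B - C) + D + (E - H)) + (H - I) = (A - C) + D + (E - I)"
      if "A \<in> carrier_mat m m" "B \<in> carrier_mat m m" "C \<in> carrier_mat m m" "D \<in> carrier_mat m m"
        "E \<in> carrier_mat m m" "H \<in> carrier_mat m m" "I \<in> carrier_mat m m"
      for A B C D E H I :: "complex poly mat"
      using that by (intro eq_matI) auto
    thus ?thesis by simp
  qed
  also have "\<dots> = diff_act (Q * T) (F, K, G)"
    unfolding diff_act_def split fwd bwd by (simp add: dist assoc)
  finally show ?thesis .
qed

lemma const_mat_index: "i < dim_row C \<Longrightarrow> j < dim_col C \<Longrightarrow> const_mat C $$ (i, j) = [:C $$ (i, j):]"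
  by (simp add: const_mat_def)

lemma const_mat_carrier: "C \<in> carrier_mat m n \<Longrightarrow> const_mat C \<in> carrier_mat m n"
  by (simp add: const_mat_def)

lemma cnj_A_mat:
  assumes "r < m" "s < m"
  shows "cnj (A_mat m a $$ (r, s)) = A_mat m a $$ (r, s)"
  using assms by (simp add: A_mat_def unit_mat_def if_distrib cong: if_cong)

text \<open>Substituting \<open>v\<^sub>r = - K\<^sub>r \<Sum>\<^sub>k \<dots>\<close> into \<open>\<Sum>\<^sub>r |v\<^sub>r|\<^sup>2 / K\<^sub>r\<close> exhibits this sum as the negative of
  another sum of squares.\<close>

lemma kernel_positive_definite:
  fixes A :: "nat \<Rightarrow> nat \<Rightarrow> complex" and K L :: "nat \<Rightarrow> real" and v :: "nat \<Rightarrow> complex"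
  assumes pos: "\<And>r. r < m \<Longrightarrow> K r > 0" "\<And>r. r < m \<Longrightarrow> L r > 0"
    and zero: "\<And>k r. k < m \<Longrightarrow> r < m \<Longrightarrow> r \<notin> S \<Longrightarrow> A k r = 0"
    and eq: "\<And>r. r < m \<Longrightarrow> r \<in> S \<Longrightarrow>
       v r + (\<Sum>s<m. (\<Sum>k<m. of_real (K r) * cnj (A k r) * inverse (of_real (L k)) * A k s) * v s) = 0"
    and r: "r < m" "r \<in> S"
  shows "v r = 0"
proof -
  define u where "u k = (\<Sum>s<m. A k s * v s)" for k
  have v: "v r / of_real (K r) = - (\<Sum>k<m. cnj (A k r) * u k / of_real (L k))" if "r < m" "r \<in> S" for r
  proof -
    have "(\<Sum>s<m. (\<Sum>k<m. of_real (K r) * cnj (A k r) * inverse (of_real (L k)) * A k s) * v s) =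
        (\<Sum>s<m. \<Sum>k<m. of_real (K r) * (cnj (A k r) / of_real (L k)) * (A k s * v s))"
      unfolding sum_distrib_right by (simp add: divide_inverse mult_ac)
    also have "\<dots> = (\<Sum>k<m. \<Sum>s<m. of_real (K r) * (cnj (A k r) / of_real (L k)) * (A k s * v s))"
      by (rule sum.swap)
    also have "\<dots> = of_real (K r) * (\<Sum>k<m. cnj (A k r) * u k / of_real (L k))"
      unfolding u_def by (simp add: sum_distrib_left sum_distrib_right sum_divide_distrib mult_ac)
    finally have "v r + of_real (K r) * (\<Sum>k<m. cnj (A k r) * u k / of_real (L k)) = 0"
      using eq[OF that] by simp
    thus ?thesis using pos(1)[OF that(1)] by (simp add: field_simps add_eq_0_iff)
  qed
  have "(\<Sum>r\<in>{..<m} \<inter> S. cnj (v r) * (v r / of_real (K r))) =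
        - (\<Sum>r\<in>{..<m} \<inter> S. \<Sum>k<m. cnj (v r) * (cnj (A k r) * u k / of_real (L k)))"
    by (subst sum_negf[symmetric], rule sum.cong) (auto simp: v sum_distrib_left)
  also have "\<dots> = - (\<Sum>k<m. \<Sum>r\<in>{..<m} \<inter> S. cnj (A k r * v r) * (u k / of_real (L k)))"
    by (subst sum.swap) (simp add: mult_ac)
  also have "\<dots> = - (\<Sum>k<m. cnj (u k) * (u k / of_real (L k)))"
  proof -
    \<comment> \<open>The columns of A outside S are zero, so the sum restricted to S is all of u
      k.\<close>
    have "(\<Sum>r\<in>{..<m} \<inter> S. cnj (A k r * v r)) = cnj (u k)" if "k < m" for k
      unfolding u_def cnj_sum using zero[OF that]
      by (intro sum.mono_neutral_left) auto
    thus ?thesis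
      by (intro arg_cong[where f = uminus] sum.cong refl)
         (simp only: sum_distrib_right[symmetric] lessThan_iff)
  qed
  finally have "complex_of_real ((\<Sum>r\<in>{..<m} \<inter> S. (cmod (v r))\<^sup>2 / K r) + (\<Sum>k<m. (cmod (u k))\<^sup>2 / L k)) = 0"
    by (simp add: complex_norm_square mult_ac flip: of_real_power)
  hence "(\<Sum>r\<in>{..<m} \<inter> S. (cmod (v r))\<^sup>2 / K r) + (\<Sum>k<m. (cmod (u k))\<^sup>2 / L k) = 0"
    using of_real_eq_0_iff by blast
  moreover have "(\<Sum>k<m. (cmod (u k))\<^sup>2 / L k) \<ge> 0" "(\<Sum>r\<in>{..<m} \<inter> S. (cmod (v r))\<^sup>2 / K r) \<ge> 0"
    using pos by (auto intro!: sum_nonneg simp: less_imp_le)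
  ultimately have "(\<Sum>r\<in>{..<m} \<inter> S. (cmod (v r))\<^sup>2 / K r) = 0" by linarith
  hence "(cmod (v r))\<^sup>2 / K r = 0"
    using pos(1) r by (subst (asm) sum_nonneg_eq_0_iff) (auto simp: less_imp_le)
  thus ?thesis using pos(1)[OF r(1)] by simp
qed

lemma invertible_matI_kernel:
  fixes B :: "complex mat"
  assumes B: "B \<in> carrier_mat m m"
    and ker: "\<And>v. (\<And>r. r < m \<Longrightarrow> (\<Sum>s<m. B $$ (r, s) * v s) = 0) \<Longrightarrow> \<forall>r<m. v r = 0"
  shows "invertible_mat B"
proof -
  have "det B \<noteq> 0"
  proof
    assume "det B = 0"
    then obtain v where v: "v \<in> carrier_vec m" "v \<noteq> 0\<^sub>v m" "B *\<^sub>v v = 0\<^sub>v m"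
      using det_0_iff_vec_prod_zero[OF B] by blast
    have "(\<Sum>s<m. B $$ (r, s) * v $ s) = 0" if "r < m" for r
    proof -
      have "(B *\<^sub>v v) $ r = (\<Sum>s<m. B $$ (r, s) * v $ s)"
        using that B v(1) by (simp add: scalar_prod_def atLeast0LessThan)
      thus ?thesis using v(3) that by simp
    qed
    from ker[OF this] have "v = 0\<^sub>v m" using v(1) by (intro eq_vecI) auto
    with v(2) show False by simp
  qed
  from det_non_zero_imp_unit[OF B this, of "()"] obtain C
    where "C \<in> carrier_mat m m" "C * B = 1\<^sub>m m" "B * C = 1\<^sub>m m"
    unfolding Units_def ring_mat_def by auto
  thus ?thesis using B unfolding invertible_mat_def inverts_mat_def by auto
qed

section \<open>The matrix-valued polynomials\<close>

definition X_mat :: "complex mat \<Rightarrow> complex poly mat" where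
  "X_mat C = [:0, 1:] \<cdot>\<^sub>m const_mat C"

lemma diff_op_add: "diff_op f g (q + r) = diff_op f g q + diff_op f g r"
  and diff_op_diff: "diff_op f g (q - r) = diff_op f g q - diff_op f g r"
  and diff_op_smult: "diff_op f g (smult c q) = smult c (diff_op f g q)"
  by (simp_all add: diff_op_def pcompose_add pcompose_diff pcompose_smult algebra_simps
      smult_diff_right smult_add_right)

lemma diff_op_0 [simp]: "diff_op f g 0 = 0"
  by (simp add: diff_op_def)

lemma has_sum_finite_sum:
  fixes f :: "'i \<Rightarrow> 'b \<Rightarrow> 'c :: topological_comm_monoid_add"
  assumes "\<And>i. i \<in> I \<Longrightarrow> (f i has_sum c i) S" "finite I"
  shows "((\<lambda>x. \<Sum>i\<in>I. f i x) has_sum (\<Sum>i\<in>I. c i)) S"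
  using assms(2,1) by (induction I rule: finite_induct) (auto intro: has_sum_add)

locale diagonal_weight =
  fixes m :: nat and N :: enat and a :: "nat \<Rightarrow> real" and w :: "nat \<Rightarrow> int \<Rightarrow> real"
    and p :: "nat \<Rightarrow> nat \<Rightarrow> complex poly"
  assumes orthogonal: "\<And>i. i \<in> {1..m} \<Longrightarrow> lattice_orthogonal N (w i) (p i)"
begin

abbreviation "A \<equiv> A_mat m a"

definition R_mat :: "nat \<Rightarrow> complex poly mat" where
  "R_mat n = P_mat m p n + const_mat A * P_mat m p (Suc n) - B_mat m N a w p n"

definition hnorm :: "nat \<Rightarrow> nat \<Rightarrow> real" where
  "hnorm s n = sqnorm N (w (Suc s)) (p (Suc s) n)"

text \<open>Entry (r, s) of the matrix in front of P_(n-1) in \<open>B_mat\<close>; as A is real,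
  its adjoint is the transpose.\<close>

definition bcoef :: "nat \<Rightarrow> nat \<Rightarrow> nat \<Rightarrow> complex" where
  "bcoef n r s = (if n = 0 then 0
     else of_real (hnorm r n) * A $$ (s, r) * inverse (of_real (hnorm s (n - 1))))"

lemma A_zero: "r < m \<Longrightarrow> s < m \<Longrightarrow> odd r \<or> even s \<Longrightarrow> A $$ (r, s) = 0"
  by (rule A_mat_index_zero)

text \<open>Counting from 0, A lives in even rows and odd columns; the coefficient is built from the
  transpose and has the opposite pattern. The later cancellations rest on this contrast.\<close>

lemma bcoef_zero: "r < m \<Longrightarrow> s < m \<Longrightarrow> even r \<or> odd s \<Longrightarrow> bcoef n r s = 0"
  using A_zero[of s r] by (auto simp: bcoef_def)

lemma hnorm_pos: "s < m \<Longrightarrow> n \<in> degrees N \<Longrightarrow> hnorm s n > 0"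
proof -
  assume s: "s < m" and n: "n \<in> degrees N"
  then interpret lattice_orthogonal N "w (Suc s)" "p (Suc s)" by (intro orthogonal) auto
  from monic_p[OF n] have "p (Suc s) n \<noteq> 0" by auto
  thus "hnorm s n > 0" unfolding hnorm_def using degree_p[OF n] n by (intro sqnorm_pos) auto
qed

lemma P_carrier [simp]: "P_mat m p n \<in> carrier_mat m m"
  by (simp add: P_mat_def)

lemma cA_carrier [simp]: "const_mat A \<in> carrier_mat m m" "X_mat A \<in> carrier_mat m m"
    "1\<^sub>m m + X_mat A \<in> carrier_mat m m" "1\<^sub>m m - X_mat A \<in> carrier_mat m m"
  unfolding X_mat_def
  by (intro minus_carrier_mat add_carrier_mat smult_carrier_mat const_mat_carrier A_mat_carrier)+

lemma P_index: "r < m \<Longrightarrow> s < m \<Longrightarrow> P_mat m p n $$ (r, s) = (if r = s then p (Suc s) n else 0)"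
  by (simp add: P_mat_def mat_diag_def)

lemma cA_index: "r < m \<Longrightarrow> s < m \<Longrightarrow> const_mat A $$ (r, s) = [:A $$ (r, s):]"
  by (rule const_mat_index) (use carrier_matD[OF A_mat_carrier[of m a]] in auto)

lemma X_index: "r < m \<Longrightarrow> s < m \<Longrightarrow> X_mat A $$ (r, s) = [:0, A $$ (r, s):]"
  using carrier_matD[OF cA_carrier(1)] by (simp add: X_mat_def cA_index)

lemma B_carrier [simp]: "B_mat m N a w p n \<in> carrier_mat m m"
proof -
  have "norm2_mat m N w p n * mat_adjoint A * norm2_inv_mat m N w p (n - 1) \<in> carrier_mat m m"
    using mat_adjoint_carrier[OF A_mat_carrier[of m a]]
    by (auto simp: norm2_mat_def norm2_inv_mat_def intro!: mult_carrier_mat[of _ m m])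
  thus ?thesis unfolding B_mat_def by (auto intro!: mult_carrier_mat[of _ m m] const_mat_carrier)
qed

lemma B_index:
  assumes rs: "r < m" "s < m"
  shows "B_mat m N a w p n $$ (r, s) = smult (bcoef n r s) (p (Suc s) (n - 1))"
proof (cases "n = 0")
  case True
  thus ?thesis using rs by (simp add: B_mat_def bcoef_def)
next
  case False
  define D where "D = norm2_mat m N w p n * mat_adjoint A * norm2_inv_mat m N w p (n - 1)"
  have c: "mat_adjoint A \<in> carrier_mat m m" by (rule mat_adjoint_carrier) simp
  have D1: "norm2_mat m N w p n * mat_adjoint A =
      Matrix.mat m m (\<lambda>(i, j). of_real (hnorm i n) * mat_adjoint A $$ (i, j))"
    unfolding norm2_mat_def hnorm_def by (rule mat_diag_mult_left[OF c])
  have D: "D = Matrix.mat m m (\<lambda>(i, j). bcoef n i j)"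
    unfolding D_def D1 norm2_inv_mat_def
    by (subst mat_diag_mult_right[where n = m and nr = m])
       (use False in \<open>auto simp: bcoef_def hnorm_def mat_adjoint_index[OF A_mat_carrier] cnj_A_mat\<close>)
  have "B_mat m N a w p n = const_mat D * P_mat m p (n - 1)" using False by (simp add: B_mat_def D_def)
  also have "\<dots> = Matrix.mat m m (\<lambda>(i, j). const_mat D $$ (i, j) * p (Suc j) (n - 1))"
    unfolding P_mat_def by (rule mat_diag_mult_right[OF const_mat_carrier]) (simp add: D)
  finally show ?thesis using rs by (simp add: D const_mat_index)
qed

lemma R_carrier [simp]: "R_mat n \<in> carrier_mat m m"
  unfolding R_mat_def by (intro minus_carrier_mat B_carrier)

lemma AP_index:
  assumes "r < m" "s < m"
  shows "(const_mat A * P_mat m p n) $$ (r, s) = smult (A $$ (r, s)) (p (Suc s) n)"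
  unfolding P_mat_def using assms
  by (subst mat_diag_mult_right[OF cA_carrier(1)]) (simp add: cA_index)

lemma R_index:
  assumes "r < m" "s < m"
  shows "R_mat n $$ (r, s) = (if r = s then p (Suc s) n else 0)
     + smult (A $$ (r, s)) (p (Suc s) (Suc n)) - smult (bcoef n r s) (p (Suc s) (n - 1))"
proof -
  have "R_mat n $$ (r, s) = P_mat m p n $$ (r, s) + (const_mat A * P_mat m p (Suc n)) $$ (r, s)
      - B_mat m N a w p n $$ (r, s)"
    unfolding R_mat_def using assms carrier_matD[OF B_carrier] carrier_matD[OF P_carrier]
      carrier_matD[OF cA_carrier(1)] by simp
  thus ?thesis by (simp only: P_index B_index AP_index assms)
qed

section \<open>Reduction of \<open>Q_mat\<close> to \<open>R_mat\<close> and the diagonal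
  weight\<close>

lemma Q_eq: "Q_mat m N a w p n =
   R_mat n - P_mat m p n * X_mat A + B_mat m N a w p n * X_mat A"
  by (simp add: Q_mat_def R_mat_def X_mat_def)

lemma Q_carrier [simp]: "Q_mat m N a w p n \<in> carrier_mat m m"
  unfolding Q_eq by (intro add_carrier_mat mult_carrier_mat[of _ m m] B_carrier cA_carrier)

lemma Q_eq_R: "Q_mat m N a w p n = R_mat n * (1\<^sub>m m - X_mat A)"
proof -
  have APX: "const_mat A * P_mat m p (Suc n) * X_mat A = 0\<^sub>m m m"
  proof (rule eq_matI)
    fix r s assume "r < dim_row (0\<^sub>m m m :: complex poly mat)" "s < dim_col (0\<^sub>m m m :: complex poly mat)"
    hence rs: "r < m" "s < m" by auto
    \<comment> \<open>The left factor needs k odd and the right one k even.\<close>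
    have "(const_mat A * P_mat m p (Suc n)) $$ (r, k) * X_mat A $$ (k, s) = 0" if "k < m" for k
      using rs that A_zero[of r k] A_zero[of k s] by (auto simp: AP_index X_index)
    hence "(\<Sum>k<m. (const_mat A * P_mat m p (Suc n)) $$ (r, k) * X_mat A $$ (k, s)) = 0"
      by (intro sum.neutral) blast
    thus "(const_mat A * P_mat m p (Suc n) * X_mat A) $$ (r, s) = 0\<^sub>m m m $$ (r, s)"
      using rs by (subst mult_mat_index_sum[of _ m]) (simp_all add: mult_carrier_mat[of _ m m])
  qed (use carrier_matD[OF cA_carrier(1)] carrier_matD[OF cA_carrier(2)] in auto)
  have AP: "const_mat A * P_mat m p (Suc n) \<in> carrier_mat m m"
    by (rule mult_carrier_mat) (rule cA_carrier P_carrier)+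
  have "R_mat n * X_mat A =
      (P_mat m p n + const_mat A * P_mat m p (Suc n)) * X_mat A - B_mat m N a w p n * X_mat A"
    unfolding R_mat_def
    by (rule minus_mult_distrib_mat) (rule add_carrier_mat AP B_carrier cA_carrier)+
  also have "(P_mat m p n + const_mat A * P_mat m p (Suc n)) * X_mat A =
      P_mat m p n * X_mat A + const_mat A * P_mat m p (Suc n) * X_mat A"
    by (rule add_mult_distrib_mat) (rule AP P_carrier cA_carrier)+
  finally have "R_mat n * X_mat A = P_mat m p n * X_mat A - B_mat m N a w p n * X_mat A"
    by (simp add: APX mult_carrier_mat[of _ m m])
  moreover have "R_mat n * (1\<^sub>m m - X_mat A) = R_mat n - R_mat n * X_mat A"
    by (simp only: mult_minus_distrib_square_mat[OF R_carrier one_carrier_mat cA_carrier(2)]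
        right_mult_one_mat[OF R_carrier])
  moreover have "E - F + G = E - (F - G)" if "E \<in> carrier_mat m m" "F \<in> carrier_mat m m" "G \<in> carrier_mat m m"
    for E F G :: "complex poly mat"
    using that by (intro eq_matI) auto
  ultimately show ?thesis unfolding Q_eq
    by (simp add: mult_carrier_mat[of _ m m])
qed

lemma X_square: "X_mat A * X_mat A = 0\<^sub>m m m"
proof (rule eq_matI)
  fix r s assume "r < dim_row (0\<^sub>m m m :: complex poly mat)" "s < dim_col (0\<^sub>m m m :: complex poly mat)"
  hence rs: "r < m" "s < m" by auto
  have "X_mat A $$ (r, k) * X_mat A $$ (k, s) = 0" if "k < m" for k
    using rs that A_zero[of r k] A_zero[of k s] by (auto simp: X_index)
  hence "(\<Sum>k<m. X_mat A $$ (r, k) * X_mat A $$ (k, s)) = 0" by (intro sum.neutral) auto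
  thus "(X_mat A * X_mat A) $$ (r, s) = 0\<^sub>m m m $$ (r, s)"
    using rs by (subst mult_mat_index_sum[of _ m]) auto
qed (use carrier_matD[OF cA_carrier(2)] in auto)

lemma T_inverse:
  "(1\<^sub>m m - X_mat A) * (1\<^sub>m m + X_mat A) = 1\<^sub>m m"
proof -
  have *: "E + F - (F + 0\<^sub>m m m) = E"
    if "E \<in> carrier_mat m m" "F \<in> carrier_mat m m" for E F :: "complex poly mat"
    using that by (auto intro!: eq_matI)
  have "(1\<^sub>m m - X_mat A) * (1\<^sub>m m + X_mat A) =
      1\<^sub>m m * (1\<^sub>m m + X_mat A) - X_mat A * (1\<^sub>m m + X_mat A)"
    by (rule minus_mult_distrib_mat) (rule one_carrier_mat cA_carrier)+
  also have "X_mat A * (1\<^sub>m m + X_mat A) = X_mat A * 1\<^sub>m m + X_mat A * X_mat A"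
    by (rule mult_add_distrib_mat) (rule one_carrier_mat cA_carrier)+
  finally show "(1\<^sub>m m - X_mat A) * (1\<^sub>m m + X_mat A) = 1\<^sub>m m"
    by (simp only: X_square left_mult_one_mat[OF cA_carrier(3)] right_mult_one_mat[OF cA_carrier(2)]
        *[OF one_carrier_mat cA_carrier(2)])
qed

lemma Q_T: "Q_mat m N a w p n * (1\<^sub>m m + X_mat A) = R_mat n"
  unfolding Q_eq_R by (subst assoc_mult_mat[of _ m m _ m _ m]) (simp_all add: T_inverse right_mult_one_mat[of _ m m])

lemma eval_T: "eval_mat (1\<^sub>m m + X_mat A) x = T_mat m a x"
  unfolding T_mat_eq
  by (rule eq_matI)
     (use carrier_matD[OF cA_carrier(2)] carrier_matD[OF A_mat_carrier[of m a]] in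
       \<open>auto simp: eval_mat_def X_index\<close>)

text \<open>Q W Q^* = (Q T) diag(w) (Q T)^* and Q T = R, so every entry is a sum over columns of
  scalar terms that \<open>moment\<close> can sum.\<close>

lemma QWQ_index:
  assumes "i < m" "j < m"
  shows "(eval_mat (Q_mat m N a w p n) (of_int x) * W_mat m a w x *
           mat_adjoint (eval_mat (Q_mat m N a w p k) (of_int x))) $$ (i, j) =
    (\<Sum>s<m. poly (R_mat n $$ (i, s) * map_poly cnj (R_mat k $$ (j, s))) (of_int x)
            * complex_of_real (w (Suc s) x))"
proof -
  let ?Q = "\<lambda>n. eval_mat (Q_mat m N a w p n) (of_int x)" and ?T = "T_mat m a (of_int x)"
    and ?D = "mat_diag m (\<lambda>i. complex_of_real (w (Suc i) x))" and ?R = "\<lambda>n. eval_mat (R_mat n) (of_int x)"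
  have [simp]: "?T \<in> carrier_mat m m" unfolding T_mat_eq by simp
  have [simp]: "?Q n \<in> carrier_mat m m" "?R n \<in> carrier_mat m m" for n
    by (auto simp: eval_mat_def)
  have [simp]: "mat_adjoint ?T \<in> carrier_mat m m" "mat_adjoint (?Q n) \<in> carrier_mat m m"
      "mat_adjoint (?R n) \<in> carrier_mat m m" for n
    by (auto intro: mat_adjoint_carrier)
  note [simp] = mult_carrier_mat[of _ m m]
  have R: "?Q n * ?T = ?R n" for n
    unfolding eval_T[symmetric] by (subst eval_mat_mult[of _ m, symmetric]) (simp_all add: Q_T)
  have "?Q n * W_mat m a w x * mat_adjoint (?Q k) = ?R n * ?D * (mat_adjoint ?T * mat_adjoint (?Q k))"
    unfolding W_mat_def R[of n, symmetric] by (simp add: assoc_mult_mat[of _ m m _ m _ m])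
  also have "mat_adjoint ?T * mat_adjoint (?Q k) = mat_adjoint (?R k)"
    unfolding R[of k, symmetric] by (rule mat_adjoint_mult[symmetric, of _ m]) simp_all
  finally have "(?Q n * W_mat m a w x * mat_adjoint (?Q k)) $$ (i, j) =
      (\<Sum>s<m. (?R n * ?D) $$ (i, s) * mat_adjoint (?R k) $$ (s, j))"
    using assms by (simp only: mult_mat_index_sum[of _ m] mat_diag_dim mult_carrier_mat[of _ m m]
      \<open>?R n \<in> carrier_mat m m\<close> \<open>mat_adjoint (?R k) \<in> carrier_mat m m\<close>)
  also have "\<dots> = (\<Sum>s<m. poly (R_mat n $$ (i, s) * map_poly cnj (R_mat k $$ (j, s))) (of_int x)
            * complex_of_real (w (Suc s) x))"
  proof (rule sum.cong)
    fix s assume "s \<in> {..<m}"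
    hence s: "s < m" by simp
    have "mat_adjoint (?R k) $$ (s, j) = cnj (?R k $$ (j, s))"
      by (rule mat_adjoint_index[of _ m m]) (use s assms in simp_all)
    moreover have "(?R n * ?D) $$ (i, s) = ?R n $$ (i, s) * complex_of_real (w (Suc s) x)"
      by (subst mat_diag_mult_right[of _ m m]) (use s assms in simp_all)
    moreover have "?R n $$ (i, s) = poly (R_mat n $$ (i, s)) (of_int x)" if "i < m" for n i
      using s that carrier_matD[OF R_carrier[of n]] by (simp add: eval_mat_def)
    ultimately show "(?R n * ?D) $$ (i, s) * mat_adjoint (?R k) $$ (s, j) =
        poly (R_mat n $$ (i, s) * map_poly cnj (R_mat k $$ (j, s))) (of_int x)
            * complex_of_real (w (Suc s) x)"
      using assms by simp
  qed simp
  finally show ?thesis .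
qed

section \<open>Degree and leading coefficient of \<open>Q_mat\<close>\<close>

lemma Q_index:
  assumes rs: "r < m" "s < m"
  shows "Q_mat m N a w p n $$ (r, s) =
    (if r = s then p (Suc s) n else 0)
     + smult (A $$ (r, s)) (p (Suc s) (Suc n) - pCons 0 (p (Suc r) n))
     - smult (bcoef n r s) (p (Suc s) (n - 1))
     + (\<Sum>l<m. smult (bcoef n r l * A $$ (l, s)) (pCons 0 (p (Suc l) (n - 1))))"
proof -
  have PX: "(P_mat m p n * X_mat A) $$ (r, s) = smult (A $$ (r, s)) (pCons 0 (p (Suc r) n))"
    unfolding P_mat_def mat_diag_mult_left[OF cA_carrier(2)] using rs by (simp add: X_index mult.commute)
  have BX: "(B_mat m N a w p n * X_mat A) $$ (r, s) =
      (\<Sum>l<m. smult (bcoef n r l * A $$ (l, s)) (pCons 0 (p (Suc l) (n - 1))))"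
    unfolding mult_mat_index_sum[OF B_carrier cA_carrier(2) rs]
    by (intro sum.cong) (simp_all add: B_index X_index rs mult_ac)
  have "Q_mat m N a w p n $$ (r, s) = R_mat n $$ (r, s) - (P_mat m p n * X_mat A) $$ (r, s)
      + (B_mat m N a w p n * X_mat A) $$ (r, s)"
    unfolding Q_eq using rs carrier_matD[OF B_carrier] carrier_matD[OF P_carrier]
      carrier_matD[OF cA_carrier(2)] by simp
  thus ?thesis unfolding PX BX R_index[OF rs] by (simp add: smult_diff_right)
qed

lemma degree_p:
  assumes "s < m" "n \<in> degrees N"
  shows "degree (p (Suc s) n) = n" "coeff (p (Suc s) n) n = 1"
    "degree (p (Suc s) (Suc n)) = Suc n" "coeff (p (Suc s) (Suc n)) (Suc n) = 1"
proof -
  from assms(1) interpret lattice_orthogonal N "w (Suc s)" "p (Suc s)" by (intro orthogonal) auto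
  show "degree (p (Suc s) n) = n" "coeff (p (Suc s) n) n = 1"
    "degree (p (Suc s) (Suc n)) = Suc n" "coeff (p (Suc s) (Suc n)) (Suc n) = 1"
    using degree_p monic_p degree_p_Suc assms(2) by blast+
qed

lemma degrees_pred: "n \<in> degrees N \<Longrightarrow> n - 1 \<in> degrees N"
  by (auto simp: degrees_def intro: order.trans[of _ "enat n"])

text \<open>In degree n + 1 the terms A P_(n+1) and P_n A x cancel, all scalar polynomials being
  monic. In degree n they leave a difference of subleading coefficients, and the last term of Q
  contributes the product of the \<open>bcoef\<close> matrix with A.\<close>

lemma coeff_Q:
  assumes rs: "r < m" "s < m" and n: "n \<in> degrees N" and k: "k \<ge> n"
  shows "coeff (Q_mat m N a w p n $$ (r, s)) k =
    (if k = n then (if r = s then 1 else 0)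
       + A $$ (r, s) * (coeff (p (Suc s) (Suc n)) n - coeff (pCons 0 (p (Suc r) n)) n)
       + (\<Sum>l<m. bcoef n r l * A $$ (l, s)) else 0)"
proof -
  have 1: "coeff (p (Suc s) n) k = (if k = n then 1 else 0)" if "s < m" for s
    using degree_p[OF that n] k by (auto simp: coeff_eq_0)
  have 2: "coeff (p (Suc s) (Suc n)) k = coeff (pCons 0 (p (Suc r) n)) k" if "k \<noteq> n"
    using degree_p[OF rs(2) n] degree_p[OF rs(1) n] that k
    by (cases "k = Suc n") (auto simp: coeff_eq_0 coeff_pCons split: nat.splits)
  have 3: "bcoef n r s * coeff (p (Suc s) (n - 1)) k = 0"
    using degree_p[OF rs(2) degrees_pred[OF n]] k by (cases "n = 0") (auto simp: coeff_eq_0 bcoef_def)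
  have 4: "bcoef n r l * A $$ (l, s) * coeff (pCons 0 (p (Suc l) (n - 1))) k =
      (if k = n then bcoef n r l * A $$ (l, s) else 0)" if "l < m" for l
  proof (cases "n = 0")
    case False
    then obtain n' where "n = Suc n'" by (cases n) auto
    thus ?thesis using degree_p[OF that degrees_pred[OF n]] k
      by (auto simp: coeff_eq_0 coeff_pCons split: nat.splits)
  qed (simp add: bcoef_def)
  have 5: "(\<Sum>l<m. bcoef n r l * A $$ (l, s) * coeff (pCons 0 (p (Suc l) (n - 1))) k) =
      (if k = n then \<Sum>l<m. bcoef n r l * A $$ (l, s) else 0)"
    using sum.cong[OF refl 4, of "{..<m}"] by auto
  show ?thesis
    unfolding Q_index[OF rs] coeff_add coeff_diff coeff_smult coeff_sum 3 5
    using 1[OF rs(2)] 2 by (cases "k = n") auto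
qed

lemma degree_Q: "r < m \<Longrightarrow> s < m \<Longrightarrow> n \<in> degrees N \<Longrightarrow> degree (Q_mat m N a w p n $$ (r, s)) \<le> n"
  by (rule degree_le) (simp add: coeff_Q)

text \<open>Let v be in the kernel. In odd rows (from 0) A vanishes, and \<open>bcoef\<close> times
  A involves only the odd entries of v; this is identity plus K A^* L^(-1) A, so
  \<open>kernel_positive_definite\<close> kills them. In even rows \<open>bcoef\<close> vanishes and
  A sees only odd entries, so the even entries of v vanish as well.\<close>

lemma invertible_coeff_Q:
  assumes n: "n \<in> degrees N"
  shows "invertible_mat (coeff_mat (Q_mat m N a w p n) n)"
proof (rule invertible_matI_kernel)
  let ?L = "coeff_mat (Q_mat m N a w p n) n"
  show "?L \<in> carrier_mat m m" using Q_carrier by (simp add: coeff_mat_def)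
  fix v assume v: "\<And>r. r < m \<Longrightarrow> (\<Sum>s<m. ?L $$ (r, s) * v s) = 0"
  define y where "y r s = coeff (p (Suc s) (Suc n)) n - coeff (pCons 0 (p (Suc r) n)) n" for r s
  have L: "?L $$ (r, s) = (if r = s then 1 else 0) + A $$ (r, s) * y r s + (\<Sum>l<m. bcoef n r l * A $$ (l, s))"
    if "r < m" "s < m" for r s
    using that carrier_matD[OF Q_carrier[of n]] by (simp add: coeff_mat_def coeff_Q n y_def)
  have eq: "v r + (\<Sum>s<m. A $$ (r, s) * y r s * v s) + (\<Sum>s<m. (\<Sum>l<m. bcoef n r l * A $$ (l, s)) * v s) = 0"
    if "r < m" for r
  proof -
    have "(\<Sum>s<m. ?L $$ (r, s) * v s) = (\<Sum>s<m. (if r = s then v s else 0) + A $$ (r, s) * y r s * v s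
        + (\<Sum>l<m. bcoef n r l * A $$ (l, s)) * v s)"
      by (intro sum.cong) (auto simp: L that distrib_right)
    thus ?thesis using v[OF that] that by (simp add: sum.distrib)
  qed
  have odd: "v r = 0" if r: "r < m" "odd r" for r
  proof (cases "n = 0")
    case True
    thus ?thesis using eq[OF r(1)] r by (simp add: bcoef_def A_zero)
  next
    case False
    show ?thesis
    proof (rule kernel_positive_definite[where K = "\<lambda>r. hnorm r n" and L = "\<lambda>r. hnorm r (n - 1)"
          and A = "\<lambda>r s. A $$ (r, s)" and S = "{r. odd r}" and m = m and v = v])
      fix r assume "r < m" "r \<in> {r. odd r}"
      with eq[of r] show "v r + (\<Sum>s<m. (\<Sum>k<m. of_real (hnorm r n) * cnj (A $$ (k, r)) *
          inverse (of_real (hnorm k (n - 1))) * A $$ (k, s)) * v s) = 0"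
        using False by (simp add: A_zero cnj_A_mat bcoef_def)
    qed (use r A_zero hnorm_pos n degrees_pred[OF n] in auto)
  qed
  show "\<forall>r<m. v r = 0"
  proof (intro allI impI)
    fix r assume r: "r < m"
    show "v r = 0"
    proof (cases "odd r")
      case False
      have "A $$ (r, s) * y r s * v s = 0" "bcoef n r s = 0" if "s < m" for s
        using odd[of s] A_zero[of r s] bcoef_zero[of r s] that r False by auto
      with eq[OF r] show ?thesis by simp
    qed (use odd r in simp)
  qed
qed

section \<open>Orthogonality of \<open>Q_mat\<close>\<close>

text \<open>Scalar orthogonality leaves only contributions with n and k adjacent. There an A term of
  one factor meets a \<open>bcoef\<close> term of the other, and the norms in \<open>bcoef\<close>
  are exactly those that make them cancel.\<close>

lemma Q_orthogonal:
  assumes ij: "i < m" "j < m" and nk: "n \<in> degrees N" "k \<in> degrees N" "n \<noteq> k"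
  shows "((\<lambda>x. (eval_mat (Q_mat m N a w p n) (of_int x) * W_mat m a w x *
           mat_adjoint (eval_mat (Q_mat m N a w p k) (of_int x))) $$ (i, j)) has_sum 0) (lattice N)"
proof -
  let ?mom = "\<lambda>s. lattice_weight.moment N (w (Suc s))"
  \<comment> \<open>The value of the moment in column s after scalar orthogonality; the cancellation
    appears only on summing over s.\<close>
  define c where "c s = (if i = s then A $$ (j, s) * (if n = Suc k then of_real (hnorm s n) else 0)
        - bcoef k j s * (if k = Suc n then of_real (hnorm s n) else 0) else 0)
      + (if j = s then A $$ (i, s) * (if k = Suc n then of_real (hnorm s k) else 0)
        - bcoef n i s * (if n = Suc k then of_real (hnorm s k) else 0) else 0)" for s
  have "((\<lambda>x. poly (R_mat n $$ (i, s) * map_poly cnj (R_mat k $$ (j, s))) (of_int x)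
            * complex_of_real (w (Suc s) x)) has_sum c s) (lattice N)" if s: "s < m" for s
  proof -
    from s interpret lattice_orthogonal N "w (Suc s)" "p (Suc s)" by (intro orthogonal) auto
    let ?p = "p (Suc s)" and ?c = "map_poly cnj"
    have cnj_add: "?c (q + r) = ?c q + ?c r" and cnj_diff: "?c (q - r) = ?c q - ?c r"
      and cnj_smult: "?c (smult d q) = smult (cnj d) (?c q)" for q r d
      by (rule poly_eqI, simp add: coeff_map_poly)+
    define M where "M u v = moment (?p u * ?c (?p v))" for u v
    have M: "M u v = (if u = v then of_real (hnorm s u) else 0)"
      if "u \<in> {n - 1, n, Suc n}" "v \<in> {k - 1, k, Suc k}" for u v
      unfolding M_def hnorm_def
      using that nk degrees_pred[OF nk(1)] degrees_pred[OF nk(2)] by (intro moment_p_p) auto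
    define \<alpha> \<alpha>' where "\<alpha> = (if i = s then 1 else 0 :: complex)" and "\<alpha>' = (if j = s then 1 else 0 :: complex)"
    define \<beta> \<beta>' where "\<beta> = A $$ (i, s)" and "\<beta>' = A $$ (j, s)"
    define \<gamma> \<gamma>' where "\<gamma> = bcoef n i s" and "\<gamma>' = bcoef k j s"
    have R: "R_mat n $$ (i, s) = smult \<alpha> (?p n) + smult \<beta> (?p (Suc n)) - smult \<gamma> (?p (n - 1))"
      by (simp add: R_index ij s \<alpha>_def \<beta>_def \<gamma>_def)
    have real: "cnj \<alpha>' = \<alpha>'" "cnj \<beta>' = \<beta>'" "cnj \<gamma>' = \<gamma>'"
      using ij s by (auto simp: \<alpha>'_def \<beta>'_def \<gamma>'_def cnj_A_mat bcoef_def)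
    have R': "?c (R_mat k $$ (j, s)) =
        smult \<alpha>' (?c (?p k)) + smult \<beta>' (?c (?p (Suc k))) - smult \<gamma>' (?c (?p (k - 1)))"
    proof -
      have "R_mat k $$ (j, s) = smult \<alpha>' (?p k) + smult \<beta>' (?p (Suc k)) - smult \<gamma>' (?p (k - 1))"
        by (simp add: R_index ij s \<alpha>'_def \<beta>'_def \<gamma>'_def)
      thus ?thesis by (simp only: cnj_add cnj_diff cnj_smult real)
    qed
    \<comment> \<open>Both factors sit in column s, where A needs s odd and \<open>bcoef\<close>
      needs s even.\<close>
    have zero: "\<beta> * \<gamma>' = 0" "\<gamma> * \<beta>' = 0"
      using A_zero[OF ij(1) s] A_zero[OF ij(2) s] bcoef_zero[OF ij(1) s] bcoef_zero[OF ij(2) s]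
      by (auto simp: \<beta>_def \<beta>'_def \<gamma>_def \<gamma>'_def)
    \<comment> \<open>Truncated subtraction identifies n - 1 and k - 1 when one index is 0 and the
      other 1, but \<open>bcoef\<close> vanishes at index 0.\<close>
    have zero': "\<gamma> * \<gamma>' * M (n - 1) (k - 1) = 0"
      using nk(3) by (cases n; cases k) (auto simp: M \<gamma>_def \<gamma>'_def bcoef_def)
    have "moment (R_mat n $$ (i, s) * ?c (R_mat k $$ (j, s))) =
        \<alpha> * \<alpha>' * M n k + \<alpha> * \<beta>' * M n (Suc k) - \<alpha> * \<gamma>' * M n (k - 1)
        + \<beta> * \<alpha>' * M (Suc n) k + \<beta> * \<beta>' * M (Suc n) (Suc k) - (\<beta> * \<gamma>') * M (Suc n) (k - 1)
        - \<gamma> * \<alpha>' * M (n - 1) k - (\<gamma> * \<beta>') * M (n - 1) (Suc k) + \<gamma> * \<gamma>' * M (n - 1) (k - 1)"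
      unfolding R R' M_def
      by (simp add: ring_distribs moment_add moment_diff moment_smult mult_smult_left mult_smult_right)
    also have "\<dots> = \<alpha> * \<beta>' * M n (Suc k) - \<alpha> * \<gamma>' * M n (k - 1) + \<beta> * \<alpha>' * M (Suc n) k - \<gamma> * \<alpha>' * M (n - 1) k"
      unfolding zero zero' using nk(3) by (simp add: M)
    also have "\<gamma>' * M n (k - 1) = \<gamma>' * (if k = Suc n then of_real (hnorm s n) else 0)"
      by (cases k) (auto simp: M \<gamma>'_def bcoef_def)
    hence "\<alpha> * \<gamma>' * M n (k - 1) = \<alpha> * \<gamma>' * (if k = Suc n then of_real (hnorm s n) else 0)"
      by (simp only: mult.assoc)
    also have "\<gamma> * M (n - 1) k = \<gamma> * (if n = Suc k then of_real (hnorm s k) else 0)"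
      by (cases n) (auto simp: M \<gamma>_def bcoef_def)
    hence "\<gamma> * \<alpha>' * M (n - 1) k = \<gamma> * \<alpha>' * (if n = Suc k then of_real (hnorm s k) else 0)"
      by (simp only: mult_ac)
    finally have "moment (R_mat n $$ (i, s) * ?c (R_mat k $$ (j, s))) = c s"
      by (simp add: c_def M \<alpha>_def \<alpha>'_def \<beta>_def \<beta>'_def \<gamma>_def \<gamma>'_def)
    thus ?thesis using moment_has_sum by metis
  qed
  hence "((\<lambda>x. (eval_mat (Q_mat m N a w p n) (of_int x) * W_mat m a w x *
           mat_adjoint (eval_mat (Q_mat m N a w p k) (of_int x))) $$ (i, j)) has_sum (\<Sum>s<m. c s)) (lattice N)"
    unfolding QWQ_index[OF ij] by (intro has_sum_finite_sum) auto
  moreover have "(\<Sum>s<m. c s) =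
      A $$ (j, i) * (if n = Suc k then of_real (hnorm i n) else 0)
        - bcoef k j i * (if k = Suc n then of_real (hnorm i n) else 0)
      + (A $$ (i, j) * (if k = Suc n then of_real (hnorm j k) else 0)
        - bcoef n i j * (if n = Suc k then of_real (hnorm j k) else 0))"
    unfolding c_def sum.distrib using ij by simp
  moreover have "\<dots> = 0"
    using hnorm_pos[OF ij(1) nk(1)] hnorm_pos[OF ij(2) nk(2)] by (auto simp: bcoef_def)
  ultimately show ?thesis by simp
qed

lemma orthogonal_sequence_Q: "orthogonal_sequence m N (W_mat m a w) (Q_mat m N a w p)"
  unfolding orthogonal_sequence_def
  using Q_carrier degree_Q invertible_coeff_Q Q_orthogonal by blast

section \<open>The difference operator having \<open>Q_mat\<close> as eigenfunction\<close>

text \<open>Diagonal matrices on the right scale columns, so column s sees only the scalar operator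
  of its own weight.\<close>

lemma diff_act_diagonal_index:
  assumes R: "R \<in> carrier_mat m m" and rs: "r < m" "s < m"
  shows "diff_act R (mat_diag m f, mat_diag m (\<lambda>s. [:\<kappa> s:]), mat_diag m (\<lambda>s. - g s)) $$ (r, s) =
         diff_op (f s) (g s) (R $$ (r, s)) + smult (\<kappa> s) (R $$ (r, s))"
proof -
  have c: "fwd_diff R \<in> carrier_mat m m" "bwd_diff R \<in> carrier_mat m m"
    using R by (auto simp: fwd_diff_def bwd_diff_def)
  show ?thesis
    using rs R unfolding diff_act_def split mat_diag_mult_right[OF c(1)] mat_diag_mult_right[OF c(2)]
      mat_diag_mult_right[OF R]
    by (simp add: fwd_diff_def bwd_diff_def diff_op_def algebra_simps)
qed

lemma eigenfunction_Q:
  fixes f0 f1 g1 :: "nat \<Rightarrow> complex" and e :: complex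
  assumes m: "m \<ge> 1"
    and pearson: "\<And>i. i \<in> {1..m} \<Longrightarrow> pearson (w i) [:f0 i, f1 i, e:] [:0, g1 i, e:]"
    and nonzero: "\<And>i. i \<in> {1..m} \<Longrightarrow> [:f0 i, f1 i, e:] \<noteq> 0 \<and> [:0, g1 i, e:] \<noteq> 0"
    and parity: "\<And>i j. i \<in> {1..m} \<Longrightarrow> j \<in> {1..m} \<Longrightarrow> odd i \<Longrightarrow> even j \<Longrightarrow>
           f1 i - g1 i = f1 j - g1 j + 2 * e"
  shows "\<exists>D \<Lambda>. second_order_operator m D \<and>
            (\<forall>n\<in>degrees N. \<Lambda> n \<in> carrier_mat m m \<and>
               diff_act (Q_mat m N a w p n) D = const_mat (\<Lambda> n) * Q_mat m N a w p n)"
proof -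
  define f where "f s = [:f0 (Suc s), f1 (Suc s), e:]" for s
  define g where "g s = [:0, g1 (Suc s), e:]" for s
  define \<sigma> where "\<sigma> s = f1 (Suc s) - g1 (Suc s)" for s
  \<comment> \<open>The shift by - \<sigma> s at odd s makes the eigenvalue there in degree n + 1
    equal n \<sigma> s + n(n + 1)e. An even r gives the same value in degree n, because \<sigma> r =
    \<sigma> s + 2 e; even indices from 0 are odd ones from 1.\<close>
  define \<kappa> where "\<kappa> s = (if even s then 0 else - \<sigma> s)" for s
  define ev where "ev s n = eigval (\<sigma> s) e n + \<kappa> s" for s n
  have ev: "ev r n = ev s (Suc n)" if "r < m" "s < m" "even r" "odd s" for r s n
  proof -
    have "\<sigma> r = \<sigma> s + 2 * e" unfolding \<sigma>_def using that by (intro parity) auto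
    thus ?thesis using that by (simp add: ev_def \<kappa>_def eigval_def algebra_simps)
  qed
  have scalar: "diff_op (f s) (g s) (p (Suc s) n) + smult (\<kappa> s) (p (Suc s) n) = smult (ev s n) (p (Suc s) n)"
      "diff_op (f s) (g s) (p (Suc s) (Suc n)) + smult (\<kappa> s) (p (Suc s) (Suc n)) =
         smult (ev s (Suc n)) (p (Suc s) (Suc n))"
    if s: "s < m" and n: "n \<in> degrees N" for s n
  proof -
    from s interpret lattice_orthogonal N "w (Suc s)" "p (Suc s)" by (intro orthogonal) auto
    have pe: "pearson (w (Suc s)) [:f0 (Suc s), f1 (Suc s), e:] [:0, g1 (Suc s), e:]"
      using pearson[of "Suc s"] s by auto
    show "diff_op (f s) (g s) (p (Suc s) n) + smult (\<kappa> s) (p (Suc s) n) = smult (ev s n) (p (Suc s) n)"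
      "diff_op (f s) (g s) (p (Suc s) (Suc n)) + smult (\<kappa> s) (p (Suc s) (Suc n)) =
         smult (ev s (Suc n)) (p (Suc s) (Suc n))"
      unfolding f_def g_def diff_op_p[OF pe n] diff_op_p_Suc[OF pe n]
      by (simp_all add: ev_def \<sigma>_def smult_add_left)
  qed
  define E where "E = (mat_diag m f, mat_diag m (\<lambda>s. [:\<kappa> s:]), mat_diag m (\<lambda>s. - g s))"
  define \<Lambda> where "\<Lambda> n = mat_diag m (\<lambda>r. ev r n)" for n
  have \<Lambda>: "\<Lambda> n \<in> carrier_mat m m" "const_mat (\<Lambda> n) = mat_diag m (\<lambda>r. [:ev r n:])" for n
    by (auto simp: \<Lambda>_def const_mat_def mat_diag_def)
  have R: "diff_act (R_mat n) E = const_mat (\<Lambda> n) * R_mat n" if n: "n \<in> degrees N" for n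
  proof (rule eq_matI)
    fix r s assume "r < dim_row (const_mat (\<Lambda> n) * R_mat n)" "s < dim_col (const_mat (\<Lambda> n) * R_mat n)"
    hence rs: "r < m" "s < m" using carrier_matD[OF R_carrier[of n]] by (auto simp: \<Lambda> mat_diag_def)
    let ?\<delta> = "\<lambda>q. diff_op (f s) (g s) q + smult (\<kappa> s) q"
    have add: "?\<delta> (q + r) = ?\<delta> q + ?\<delta> r" "?\<delta> (q - r) = ?\<delta> q - ?\<delta> r" "?\<delta> (smult c q) = smult c (?\<delta> q)"
      for q r c
      by (simp_all add: diff_op_add diff_op_diff diff_op_smult smult_add_right smult_diff_right mult.commute)
    have e1: "A $$ (r, s) * ev s (Suc n) = A $$ (r, s) * ev r n"
      using A_zero[OF rs] ev[OF rs] by (cases "odd r \<or> even s") auto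
    \<comment> \<open>A nonzero coefficient has r odd and s even, the transposed situation, so the
      matching is used from degree n - 1 to n, with n > 0.\<close>
    have e2: "bcoef n r s * ev s (n - 1) = bcoef n r s * ev r n"
    proof (cases "n = 0 \<or> even r \<or> odd s")
      case True
      hence "bcoef n r s = 0"
      proof (elim disjE)
        assume "n = 0" thus ?thesis by (simp add: bcoef_def)
      qed (use bcoef_zero[OF rs] in auto)
      thus ?thesis by simp
    next
      case False
      with ev[OF rs(2,1), of "n - 1"] show ?thesis by simp
    qed
    have e3: "?\<delta> (if r = s then p (Suc s) n else 0) = smult (ev r n) (if r = s then p (Suc s) n else 0)"
      using scalar(1)[OF rs(2) n] by simp
    have "?\<delta> (R_mat n $$ (r, s)) = smult (ev r n) (R_mat n $$ (r, s))"
      unfolding R_index[OF rs] add e3 scalar(2)[OF rs(2) n] scalar(1)[OF rs(2) degrees_pred[OF n]]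
      unfolding smult_smult e1 e2
      by (simp add: smult_add_right smult_diff_right mult.commute)
    moreover have "(const_mat (\<Lambda> n) * R_mat n) $$ (r, s) = smult (ev r n) (R_mat n $$ (r, s))"
      unfolding \<Lambda> mat_diag_mult_left[OF R_carrier] using rs by simp
    ultimately show "diff_act (R_mat n) E $$ (r, s) = (const_mat (\<Lambda> n) * R_mat n) $$ (r, s)"
      unfolding E_def diff_act_diagonal_index[OF R_carrier rs] by simp
  qed (use carrier_matD[OF R_carrier[of n]] in \<open>auto simp: \<Lambda> E_def diff_act_def fwd_diff_def bwd_diff_def mat_diag_def\<close>)
  define T where "T = 1\<^sub>m m + X_mat A"
  define T' where "T' = 1\<^sub>m m - X_mat A"
  define U where "U = map_mat (\<lambda>q. q \<circ>\<^sub>p [:1, 1:]) T"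
  define V where "V = map_mat (\<lambda>q. q \<circ>\<^sub>p [:-1, 1:]) T"
  define F where "F = mat_diag m f"
  define K where "K = mat_diag m (\<lambda>s. [:\<kappa> s:])"
  define G where "G = mat_diag m (\<lambda>s. - g s)"
  define D where "D = (U * F * T', ((U - T) * F + T * K + (T - V) * G) * T', V * G * T')"
  have carrier: "T \<in> carrier_mat m m" "T' \<in> carrier_mat m m" "U \<in> carrier_mat m m" "V \<in> carrier_mat m m"
      "F \<in> carrier_mat m m" "K \<in> carrier_mat m m" "G \<in> carrier_mat m m"
    unfolding T_def T'_def U_def V_def F_def K_def G_def
    by (intro map_carrier_mat[THEN iffD2] cA_carrier mat_diag_dim)+
  have T'T: "T' * T = 1\<^sub>m m" unfolding T_def T'_def by (rule T_inverse)
  \<comment> \<open>The entry (0, 0) of A is 0, so no shift affects that of T; it will witness that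
    the leading parts are nonzero.\<close>
  have T00: "U $$ (0, 0) = 1" "V $$ (0, 0) = 1"
    using m carrier_matD[OF cA_carrier(2)] A_zero[of 0 0]
    by (auto simp: U_def V_def T_def X_index pcompose_pCons)
  \<comment> \<open>Multiplying by T on the right removes T', and the (0, 0) entry of what is left
    is h 0.\<close>
  have nz: "S * mat_diag m h * T' \<noteq> 0\<^sub>m m m"
    if S: "S \<in> carrier_mat m m" "S $$ (0, 0) = 1" and h: "h 0 \<noteq> 0" for S and h :: "nat \<Rightarrow> complex poly"
  proof
    assume eq: "S * mat_diag m h * T' = 0\<^sub>m m m"
    have c: "S * mat_diag m h \<in> carrier_mat m m" by (rule mult_carrier_mat[OF S(1) mat_diag_dim])
    have "S * mat_diag m h = S * mat_diag m h * (T' * T)"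
      unfolding T'T right_mult_one_mat[OF c] ..
    also have "\<dots> = S * mat_diag m h * T' * T"
      by (rule assoc_mult_mat[OF c carrier(2,1), symmetric])
    also have "\<dots> = 0\<^sub>m m m" unfolding eq by (rule left_mult_zero_mat[OF carrier(1)])
    finally have "(S * mat_diag m h) $$ (0, 0) = 0" using m by simp
    moreover have "(S * mat_diag m h) $$ (0, 0) = h 0"
      unfolding mat_diag_mult_right[OF S(1)] using m S(2) by simp
    ultimately show False using h by simp
  qed
  have "f 0 \<noteq> 0" "- g 0 \<noteq> 0" using nonzero[of 1] m unfolding f_def g_def by auto
  hence "U * F * T' \<noteq> 0\<^sub>m m m" "V * G * T' \<noteq> 0\<^sub>m m m"
    unfolding F_def G_def
    using nz[OF carrier(3) T00(1), of f] nz[OF carrier(4) T00(2), of "\<lambda>s. - g s"] by blast+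
  moreover have "U * F * T' \<in> carrier_mat m m" "V * G * T' \<in> carrier_mat m m"
      "((U - T) * F + T * K + (T - V) * G) * T' \<in> carrier_mat m m"
    by (intro mult_carrier_mat[of _ m m] add_carrier_mat minus_carrier_mat carrier)+
  ultimately have "second_order_operator m D"
    unfolding second_order_operator_def D_def by blast
  moreover have "diff_act (Q_mat m N a w p n) D = const_mat (\<Lambda> n) * Q_mat m N a w p n"
    if n: "n \<in> degrees N" for n
  proof -
    have "diff_act (Q_mat m N a w p n) D = diff_act (Q_mat m N a w p n * T) (F, K, G) * T'"
      unfolding D_def U_def V_def
      by (rule diff_act_conjugate[OF Q_carrier carrier(1,2,5,6,7)])
    also have "\<dots> = const_mat (\<Lambda> n) * R_mat n * T'"
      unfolding T_def Q_T F_def K_def G_def using R[OF n] by (simp add: E_def)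
    also have "\<dots> = const_mat (\<Lambda> n) * (R_mat n * T')"
      by (rule assoc_mult_mat[OF const_mat_carrier[OF \<Lambda>(1)] R_carrier carrier(2)])
    also have "R_mat n * T' = Q_mat m N a w p n" unfolding T'_def Q_eq_R ..
    finally show ?thesis .
  qed
  ultimately show ?thesis using \<Lambda>(1) by blast
qed

end

theorem theorem4p1:
  fixes m :: nat and N :: enat
    and w :: "nat \<Rightarrow> int \<Rightarrow> real"
    and a :: "nat \<Rightarrow> real"
    and p :: "nat \<Rightarrow> nat \<Rightarrow> complex poly"
  assumes "m \<ge> 1"
    and "\<forall>i\<in>{1..m}. scalar_weight N (w i)"
    and "N = \<infinity> \<and>
           ((\<forall>i\<in>{1..m}. charlier_type (w i)) \<or>
            (\<forall>i\<in>{1..m}. meixner_type (w i)) \<or>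
            (\<forall>i\<in>{1..m}. charlier_type (w i) \<or> meixner_type (w i))) \<or>
         (\<exists>M::nat. M \<ge> 1 \<and> N = enat M \<and>
           ((\<forall>i\<in>{1..m}. krawtchouk_type M (w i)) \<or> hahn_family M m w))"
    and "\<forall>j\<in>{1..m - 1}. a j \<noteq> 0"
    and "\<forall>i\<in>{1..m}. monic_orthogonal N (w i) (p i)"
  shows "orthogonal_sequence m N (W_mat m a w) (Q_mat m N a w p) \<and>
         (\<exists>D \<Lambda>. second_order_operator m D \<and>
            (\<forall>n\<in>degrees N. \<Lambda> n \<in> carrier_mat m m \<and>
               diff_act (Q_mat m N a w p n) D = const_mat (\<Lambda> n) * Q_mat m N a w p n))"
proof -
  interpret diagonal_weight m N a w p
    by unfold_locales (use assms(2,5) in auto)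
  obtain f0 f1 g1 e
    where "\<And>i. i \<in> {1..m} \<Longrightarrow> pearson (w i) [:f0 i, f1 i, e:] [:0, g1 i, e:]"
      and "\<And>i. i \<in> {1..m} \<Longrightarrow> [:f0 i, f1 i, e:] \<noteq> 0 \<and> [:0, g1 i, e:] \<noteq> 0"
      and "\<And>i j. i \<in> {1..m} \<Longrightarrow> j \<in> {1..m} \<Longrightarrow> odd i \<Longrightarrow> even j \<Longrightarrow>
             f1 i - g1 i = f1 j - g1 j + 2 * e"
    by (rule pearson_families[OF assms(3)]) blast
  from eigenfunction_Q[OF assms(1) this] orthogonal_sequence_Q show ?thesis by blast
qed

end
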